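(* Let $n$ be an odd positive integer and let $C=vC_1\oplus(1-v)C_2$ be a cyclic code of length $n$ over $R=\mathbb{Z}_4+v\mathbb{Z}_4$, $v^2=v$, generated as $$C=\langle v\,p_1(x)q_1(x),\;2v\,p_1(x),\;(1-v)\,p_2(x)q_2(x),\;2(1-v)\,p_2(x)\rangle,$$ where $p_i,q_i,r_i\in\mathbb{Z}_4[x]$ are monic with $p_1(x)q_1(x)r_1(x)=p_2(x)q_2(x)r_2(x)=x^n-1$, $C_1=\langle p_1(x)q_1(x),2p_1(x)\rangle$ and $C_2=\langle p_2(x)q_2(x),2p_2(x)\rangle$ over $\mathbb{Z}_4$. Then $\mathrm{Hull}(C)$ is the ideal of $R[x]/\langle x^n-1\rangle$ generated by $$v\,\mathrm{lcm}(p_1q_1,\,r_1^*q_1^* ),\quad 2v\,\mathrm{lcm}(p_1,\,r_1^* ),\quad (1-v)\,\mathrm{lcm}(p_2q_2,\,r_2^*q_2^* ),\quad 2(1-v)\,\mathrm{lcm}(p_2,\,r_2^* ).$$ In addition, $\mathrm{Hull}(C)$ is of type $4^{\deg R_1(x)+\deg R_2(x)}\,2^{\deg Q_1(x)+\deg Q_2(x)}$, where for $i=1,2$ $$R_i(x)=\gcd(r_i(x),p_i^*(x)),\qquad Q_i(x)=\frac{x^n-1}{\gcd(r_i(x),p_i^*(x))\cdot\mathrm{lcm}(p_i(x),r_i^*(x))}.$$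
   Context: $R=\mathbb{Z}_4[v]/\langle v^2-v\rangle=\mathbb{Z}_4+v\mathbb{Z}_4$. A linear code of length $n$ over a commutative ring $A$ is an $A$-submodule of $A^n$; it is cyclic if closed under the cyclic shift, equivalently, under $(c_0,\dots,c_{n-1})\leftrightarrow c_0+c_1x+\dots+c_{n-1}x^{n-1}$, it is an ideal of $A[x]/\langle x^n-1\rangle$. Every linear code over $R$ is uniquely $C=vC_1\oplus(1-v)C_2=\{vc_1+(1-v)c_2:c_i\in C_i\}$ with $C_1,C_2$ linear over $\mathbb{Z}_4$, and $C$ is cyclic iff $C_1,C_2$ are. For odd $n$, every cyclic code of length $n$ over $\mathbb{Z}_4$ is $\langle fg,2f\rangle$ for unique monic $f,g,h\in\mathbb{Z}_4[x]$ with $fgh=x^n-1$. For $h,k\in R^n$, $h\cdot k=\sum_i h_ik_i$; the dual is $C^\perp=\{h\in R^n: h\cdot k=0\ \forall k\in C\}$, and $\mathrm{Hull}(C)=C\cap C^\perp$. The reciprocal polynomial of a polynomial $h(x)$ with unit constant term $a_0$ is $h^*(x)=a_0^{-1}x^{\deg h}h(1/x)$. For odd $n$, $x^n-1$ factors uniquely over $\mathbb{Z}_4$ as a product of distinct, pairwise coprime monic basic irreducible polynomials (monic polynomials irreducible modulo 2); $\gcd$ and $\mathrm{lcm}$ of monic divisors of $x^n-1$ in $\mathbb{Z}_4[x]$ are taken with respect to this factorization and are monic. A code is of type $4^{k_1}2^{k_2}$ if as a $\mathbb{Z}_4$-module it is isomorphic to $\mathbb{Z}_4^{k_1}\oplus\mathbb{Z}_2^{k_2}$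 (for the cyclic code $\langle fg,2f\rangle$ over $\mathbb{Z}_4$ above, the type is $4^{\deg h}2^{\deg g}$). *)

theory Defs
  imports
    "HOL-Library.Numeral_Type"
    "HOL-Library.Z2"
    "HOL-Computational_Algebra.Polynomial"
    "HOL-Algebra.QuotRing"
    "Jordan_Normal_Form.VS_Connect"
begin

text \<open>
  \<open>\<int>\<^sub>4\<close> is the numeral type \<open>4\<close>, \<open>\<int>\<^sub>2\<close> is the field \<open>bit\<close>.  Vectors of length \<open>n\<close> over \<open>A\<close>
  are the elements of \<^const>\<open>carrier_vec\<close> \<open>n\<close>, and \<^const>\<open>class_ring\<close> is a type-class ring
  viewed as a ring record.
\<close>

text \<open>\<open>Z4v a b\<close> stands for \<open>a + b v\<close>.\<close>

datatype z4v = Z4v (const_part: 4) (v_part: 4)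

instantiation z4v :: comm_ring_1
begin

definition "0 = Z4v 0 0"
definition "1 = Z4v 1 0"
definition "x + y = Z4v (const_part x + const_part y) (v_part x + v_part y)"
definition "x - y = Z4v (const_part x - const_part y) (v_part x - v_part y)"
definition "- x = Z4v (- const_part x) (- v_part x)"
definition "x * y = Z4v (const_part x * const_part y)
  (const_part x * v_part y + v_part x * const_part y + v_part x * v_part y)"

lemmas z4v_defs = zero_z4v_def one_z4v_def plus_z4v_def minus_z4v_def uminus_z4v_def times_z4v_def

instance
  by standard (auto simp: z4v_defs z4v.expand algebra_simps intro!: z4v.expand)

end

definition vv :: z4v where
  "vv = Z4v 0 1"

definition emb :: "4 \<Rightarrow> z4v" where
  "emb a = Z4v a 0"

text \<open>
  The next three facts say that evaluation at \<open>v\<close> is a surjection \<open>\<int>\<^sub>4[v] \<rightarrow> z4v\<close> with kernel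
  \<open>\<langle>v\<^sup>2 - v\<rangle>\<close>, i.e. that \<^typ>\<open>z4v\<close> is \<open>\<int>\<^sub>4[v]/\<langle>v\<^sup>2 - v\<rangle>\<close>.
\<close>

definition eval_v :: "4 poly \<Rightarrow> z4v" where
  "eval_v f = poly (map_poly emb f) vv"

lemma emb_0 [simp]: "emb 0 = 0"
  by (simp add: emb_def z4v_defs)

lemma emb_hom: "emb 1 = 1" "emb (a + b) = emb a + emb b" "emb (a * b) = emb a * emb b"
  by (simp_all add: emb_def z4v_defs)

lemma eval_v_0 [simp]: "eval_v 0 = 0"
  by (simp add: eval_v_def)

lemma eval_v_pCons [simp]: "eval_v (pCons a f) = emb a + vv * eval_v f"
proof (cases "a = 0 \<and> f = 0")
  case False
  then show ?thesis by (auto simp: eval_v_def map_poly_pCons)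
qed (auto simp: eval_v_def)

lemma eval_v_add: "eval_v (f + g) = eval_v f + eval_v g"
proof (induction f g rule: poly_induct2)
  case (pCons a p b q)
  then show ?case by (simp add: emb_hom algebra_simps)
qed simp

lemma eval_v_smult: "eval_v (Polynomial.smult a f) = emb a * eval_v f"
  by (induction f) (simp_all add: emb_hom algebra_simps)

lemma eval_v_hom: "eval_v 1 = 1" "eval_v (f + g) = eval_v f + eval_v g"
  "eval_v (f * g) = eval_v f * eval_v g"
proof -
  show "eval_v 1 = 1" by (simp add: one_pCons emb_hom)
  show "eval_v (f * g) = eval_v f * eval_v g"
    by (induction f) (simp_all add: eval_v_add eval_v_smult algebra_simps)
qed (rule eval_v_add)

lemma surj_eval_v: "surj eval_v"
proof (rule surjI)
  show "eval_v [:const_part x, v_part x:] = x" for x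
    by (cases x) (simp add: emb_def vv_def z4v_defs)
qed

lemma eval_v_eq_0_iff: "eval_v f = 0 \<longleftrightarrow> [:0, -1, 1:] dvd f"
proof
  have vv_idem: "vv * vv = vv" by (simp add: vv_def z4v_defs)
  have ev: "eval_v [:0, -1, 1:] = 0" by (simp add: vv_def emb_def z4v_defs)
  show "eval_v f = 0" if "[:0, -1, 1:] dvd f"
  proof -
    from that obtain q where "f = [:0, -1, 1:] * q" by (rule dvdE)
    then show ?thesis by (simp only: eval_v_hom ev mult_zero_left)
  qed
  have "\<exists>q a b. f = [:0, -1, 1:] * q + [:a, b:]"
  proof (induction f)
    case 0
    show ?case by (rule exI[of _ 0], rule exI[of _ 0], rule exI[of _ 0]) simp
  next
    case (pCons c f)
    then obtain q a b where "f = [:0, -1, 1:] * q + [:a, b:]" by blast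
    then have "pCons c f = [:0, -1, 1:] * (pCons 0 q + [:b:]) + [:c, a + b:]"
      by (simp add: algebra_simps)
    then show ?case by blast
  qed
  then obtain q a b where f: "f = [:0, -1, 1:] * q + [:a, b:]" by blast
  have "eval_v f = Z4v a b"
    by (simp only: f eval_v_hom ev) (simp add: emb_def vv_def z4v_defs)
  then show "[:0, -1, 1:] dvd f" if "eval_v f = 0"
  proof -
    have "a = 0" "b = 0" using that \<open>eval_v f = Z4v a b\<close> by (simp_all add: zero_z4v_def)
    then have "f = [:0, -1, 1:] * q" using f by simp
    then show ?thesis by (rule dvdI)
  qed
qed

definition linear_code :: "nat \<Rightarrow> 'a::comm_ring_1 vec set \<Rightarrow> bool" where
  "linear_code n C \<longleftrightarrow> Module.submodule C class_ring (module_vec TYPE('a) n)"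

definition cyclic_shift :: "'a vec \<Rightarrow> 'a vec" where
  "cyclic_shift c = vec (dim_vec c) (\<lambda>i. c $ ((i + dim_vec c - 1) mod dim_vec c))"

definition cyclic_code :: "nat \<Rightarrow> 'a::comm_ring_1 vec set \<Rightarrow> bool" where
  "cyclic_code n C \<longleftrightarrow> linear_code n C \<and> (\<forall>c\<in>C. cyclic_shift c \<in> C)"

definition dual_code :: "nat \<Rightarrow> 'a::comm_ring_1 vec set \<Rightarrow> 'a vec set" where
  "dual_code n C = {h \<in> carrier_vec n. \<forall>k\<in>C. h \<bullet> k = 0}"

definition hull_code :: "nat \<Rightarrow> 'a::comm_ring_1 vec set \<Rightarrow> 'a vec set" where
  "hull_code n C = C \<inter> dual_code n C"

definition v_sum :: "4 vec set \<Rightarrow> 4 vec set \<Rightarrow> z4v vec set" where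
  "v_sum C1 C2 =
    {vv \<cdot>\<^sub>v map_vec emb c1 + (1 - vv) \<cdot>\<^sub>v map_vec emb c2 | c1 c2. c1 \<in> C1 \<and> c2 \<in> C2}"

definition xn1 :: "nat \<Rightarrow> 'a::comm_ring_1 poly" where
  "xn1 n = Polynomial.monom 1 n - 1"

definition cyc_ring :: "nat \<Rightarrow> 'a::comm_ring_1 poly set ring" where
  "cyc_ring n = class_ring Quot (PIdl\<^bsub>class_ring\<^esub> (xn1 n))"

definition cyc_class :: "nat \<Rightarrow> 'a::comm_ring_1 poly \<Rightarrow> 'a poly set" where
  "cyc_class n f = (PIdl\<^bsub>class_ring\<^esub> (xn1 n)) +>\<^bsub>class_ring\<^esub> f"

definition code_poly :: "'a::comm_ring_1 vec \<Rightarrow> 'a poly" where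
  "code_poly c = (\<Sum>i<dim_vec c. Polynomial.monom (c $ i) i)"

text \<open>
  \<open>C = \<langle>G\<rangle>\<close>: under \<open>c \<leftrightarrow> c\<^sub>0 + c\<^sub>1 x + \<dots>\<close>, the code \<open>C\<close> is the ideal of \<open>A[x]/\<langle>x\<^sup>n - 1\<rangle>\<close>
  generated by the classes of the polynomials in \<open>G\<close>.
\<close>

definition generated_by :: "nat \<Rightarrow> 'a::comm_ring_1 vec set \<Rightarrow> 'a poly set \<Rightarrow> bool" where
  "generated_by n C G \<longleftrightarrow>
    C \<subseteq> carrier_vec n \<and>
    (\<lambda>c. cyc_class n (code_poly c)) ` C = Idl\<^bsub>cyc_ring n\<^esub> (cyc_class n ` G)"

definition emb_poly :: "z4v \<Rightarrow> 4 poly \<Rightarrow> z4v poly" where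
  "emb_poly a f = Polynomial.smult a (map_poly emb f)"

text \<open>Reduction modulo 2; \<^const>\<open>Rep_bit0\<close> gives the representative in \<open>{0,1,2,3}\<close>.\<close>

definition red2 :: "4 \<Rightarrow> bit" where
  "red2 a = of_int (Rep_bit0 a)"

definition basic_factors :: "nat \<Rightarrow> 4 poly set" where
  "basic_factors n =
    {f. lead_coeff f = 1 \<and> Factorial_Ring.irreducible (map_poly red2 f) \<and> f dvd xn1 n}"

text \<open>
  For odd \<open>n\<close> the polynomial \<open>x\<^sup>n - 1\<close> is the product of \<^term>\<open>basic_factors n\<close>, each occurring
  once, so that a monic divisor is determined by the set of basic factors dividing it.
\<close>

definition gcd_xn1 :: "nat \<Rightarrow> 4 poly \<Rightarrow> 4 poly \<Rightarrow> 4 poly" where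
  "gcd_xn1 n f g = \<Prod>{b \<in> basic_factors n. b dvd f \<and> b dvd g}"

definition lcm_xn1 :: "nat \<Rightarrow> 4 poly \<Rightarrow> 4 poly \<Rightarrow> 4 poly" where
  "lcm_xn1 n f g = \<Prod>{b \<in> basic_factors n. b dvd f \<or> b dvd g}"

text \<open>
  \<^const>\<open>reflect_poly\<close> \<open>h\<close> is \<open>x\<^bsup>deg h\<^esup> h(1/x)\<close>; the inverse is only meaningful if the constant term
  is a unit.
\<close>

definition reciprocal :: "4 poly \<Rightarrow> 4 poly" where
  "reciprocal h = Polynomial.smult (inv\<^bsub>class_ring\<^esub> (Polynomial.coeff h 0)) (reflect_poly h)"

text \<open>
  The quotient \<open>f / g\<close>; it is unique when \<open>g\<close> is monic and divides \<open>f\<close>.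
\<close>

definition exact_quotient :: "4 poly \<Rightarrow> 4 poly \<Rightarrow> 4 poly" where
  "exact_quotient f g = (THE q. f = q * g)"

text \<open>A code over \<^typ>\<open>z4v\<close> as a \<open>\<int>\<^sub>4\<close>-module; the fields \<open>mult\<close> and \<open>one\<close> are irrelevant.\<close>

definition module_of_code :: "nat \<Rightarrow> z4v vec set \<Rightarrow> (4, z4v vec) module" where
  "module_of_code n C = \<lparr>
    carrier = C,
    mult = undefined,
    one = undefined,
    zero = 0\<^sub>v n,
    add = (+),
    smult = (\<lambda>a c. emb a \<cdot>\<^sub>v c)\<rparr>"

definition std_module :: "nat \<Rightarrow> nat \<Rightarrow> (4, 4 vec \<times> bit vec) module" where
  "std_module k1 k2 = \<lparr>
    carrier = carrier_vec k1 \<times> carrier_vec k2,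
    mult = undefined,
    one = undefined,
    zero = (0\<^sub>v k1, 0\<^sub>v k2),
    add = (\<lambda>(x, y) (x', y'). (x + x', y + y')),
    smult = (\<lambda>a (x, y). (a \<cdot>\<^sub>v x, red2 a \<cdot>\<^sub>v y))\<rparr>"

definition of_type :: "nat \<Rightarrow> z4v vec set \<Rightarrow> nat \<Rightarrow> nat \<Rightarrow> bool" where
  "of_type n C k1 k2 \<longleftrightarrow>
    (\<exists>\<phi> \<in> LinearCombinations.module_hom class_ring (std_module k1 k2) (module_of_code n C).
      bij_betw \<phi> (carrier (std_module k1 k2)) (carrier (module_of_code n C)))"

end

(*
  A Z4-code <p q, 2 p> with p q r = x^n - 1 is cut out by divisibility: it consists of the c with
  p | c and p q | 2 c.  Its dual is described in the same way by the reciprocals of r and q, because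
  h is orthogonal to all shifts of c iff x^n - 1 divides the product of c with the reversal of h.
  Hence the hull is { c. G | c, F | 2 c } with G and F the two lcms, and F = G Q, F R = x^n - 1 by
  counting basic irreducible factors.  Its elements are uniquely a F + 2 b G with deg a < deg R and
  b modulo 2 of degree < deg Q, which gives the type.  Over R everything splits along the orthogonal
  idempotents v and 1 - v.  The lcms make sense since every monic divisor of x^n - 1 is a product of
  distinct pairwise comaximal basic irreducible factors: for odd n the polynomial x^n - 1 is
  squarefree modulo 2, and coprime factorizations modulo 2 lift to Z4.
*)
theory Submission
  imports Defs "Jordan_Normal_Form.Char_Poly"
begin

subsection \<open>Division by monic polynomials\<close>

text \<open>Z4[x] has zero divisors and its factorizations are not unique, so only monic polynomials
  are divided by or cancelled, and coprimality is replaced by Bezout identities. The bridge to the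
  field with two elements is that in Z4 the kernel of reduction, the multiples of 2 and the
  annihilator of 2 coincide: \<open>2 * f\<close> carries exactly the information in
  \<open>red f\<close>, and since products of even elements vanish, a factorization modulo 2 lifts
  after a single correction.

  Describing codes by divisibility turns the intersection with the dual into a conjunction, so each
  of the two conditions acquires an lcm. For the reversal h of a word, cancelling p q, respectively
  p, from x^n - 1 = p q r leaves r | h and q r | 2 h as the orthogonality conditions; this is where
  the reciprocals of r and of r q come from. The basic factors missing from F are those missing from
  both of its arguments, that is, the common factors of r and the reciprocal of p. This is why the
  cofactor of F is the gcd R.\<close>

lemma monic_mult_comm_ring:
  fixes f g :: "'a::comm_ring_1 poly"
  assumes "monic f" "monic g"
  shows "monic (f * g)" "degree (f * g) = degree f + degree g"
proof -
  have "g \<noteq> 0" using assms(2) by auto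
  then show d: "degree (f * g) = degree f + degree g" using degree_monic_mult[OF assms(1)] by blast
  show "monic (f * g)" unfolding d lcoeff_monic_mult[OF assms(1)] by (rule assms(2))
qed

lemma monic_factor_comm_ring:
  fixes f g :: "'a::comm_ring_1 poly"
  assumes "monic (f * g)" "monic f"
  shows "monic g"
proof -
  have "g \<noteq> 0" using assms(1) by auto
  from assms(1) show ?thesis
    unfolding degree_monic_mult[OF assms(2) \<open>g \<noteq> 0\<close>] lcoeff_monic_mult[OF assms(2)] .
qed

text \<open>Multiplication by a monic polynomial preserves the leading coefficient, so it is
  injective even in the presence of zero divisors.\<close>

lemma monic_mult_eq_0_iff:
  fixes f g :: "'a::comm_ring_1 poly"
  assumes "monic f"
  shows "f * g = 0 \<longleftrightarrow> g = 0"
  using lcoeff_monic_mult[OF assms, of g] by (metis coeff_0 leading_coeff_0_iff mult_zero_right)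

lemma monic_mult_cancel:
  fixes f g h :: "'a::comm_ring_1 poly"
  assumes "monic f"
  shows "f * g = f * h \<longleftrightarrow> g = h"
  using monic_mult_eq_0_iff[OF assms, of "g - h"] by (simp add: right_diff_distrib)

lemma monic_mult_dvd_cancel:
  fixes f g h :: "'a::comm_ring_1 poly"
  assumes "monic f"
  shows "f * g dvd f * h \<longleftrightarrow> g dvd h"
proof
  assume "f * g dvd f * h"
  then obtain k where "f * h = f * (g * k)" by (auto simp: dvd_def mult.assoc)
  then show "g dvd h" using monic_mult_cancel[OF assms] by auto
qed (rule mult_dvd_mono[OF dvd_refl])

text \<open>Pseudo-division scales \<open>f\<close> by a power of the leading coefficient of
  \<open>g\<close>; this is 1 here, so true division with remainder results over any commutative
  ring.\<close>

lemma monic_division: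
  fixes f g :: "'a::comm_ring_1 poly"
  assumes "monic g"
  obtains q r where "f = g * q + r" "r = 0 \<or> degree r < degree g"
proof -
  have "g \<noteq> 0" using assms by auto
  obtain q r where "pseudo_divmod f g = (q, r)" by (cases "pseudo_divmod f g")
  from pseudo_divmod[OF \<open>g \<noteq> 0\<close> this] show ?thesis using that[of q r] assms by simp
qed

text \<open>The disjunct \<open>r = 0\<close> covers \<open>n = 0\<close>, as the zero polynomial
  has degree 0; the coefficient form makes closure under sums and differences immediate.\<close>

lemma degree_less_iff_coeff:
  "(r = 0 \<or> degree r < n) \<longleftrightarrow> (\<forall>i\<ge>n. coeff r i = 0)"
proof
  assume "\<forall>i\<ge>n. coeff r i = 0"
  then show "r = 0 \<or> degree r < n" by (metis leading_coeff_0_iff not_le)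
qed (auto simp: coeff_eq_0)

subsection \<open>Comaximal elements\<close>

text \<open>A Bezout identity is stronger than the absence of common non-unit divisors. It yields
  Euclid's lemma without unique factorization and is compatible with reduction modulo 2.\<close>

definition comaximal :: "'a::comm_ring_1 \<Rightarrow> 'a \<Rightarrow> bool" where
  "comaximal a b \<longleftrightarrow> (\<exists>u v. u * a + v * b = 1)"

lemma comaximalI: "u * a + v * b = 1 \<Longrightarrow> comaximal a b"
  by (auto simp: comaximal_def)

lemma comaximal_sym: "comaximal a b \<Longrightarrow> comaximal b a"
  unfolding comaximal_def by (metis add.commute)

lemma comaximal_mult:
  assumes "comaximal a c" "comaximal b c"
  shows "comaximal (a * b) c"
proof -
  from assms obtain u v s t where 1: "u * a + v * c = 1" "s * b + t * c = 1"
    by (auto simp: comaximal_def)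
  \<comment> \<open>Expand the product of the two Bezout identities: every term except the one in
    \<open>a * b\<close> contains \<open>c\<close>.\<close>
  have "(u * s) * (a * b) + (u * a * t + v * s * b + v * t * c) * c
      = (u * a + v * c) * (s * b + t * c)" by (simp add: algebra_simps)
  with 1 show ?thesis by (intro comaximalI) simp
qed

lemma comaximal_prod:
  assumes "finite T" "\<And>b. b \<in> T \<Longrightarrow> comaximal b c"
  shows "comaximal (\<Prod>T) c"
  using assms
proof (induction T rule: finite_induct)
  case empty
  show ?case by (intro comaximalI[of 1 _ 0]) simp
next
  case (insert b T)
  then show ?case by (simp add: comaximal_mult)
qed

text \<open>Euclid's lemma, by multiplying the Bezout identity by \<open>c\<close>.\<close>

lemma comaximal_dvd_mult:
  assumes "comaximal a b" "a dvd b * c"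
  shows "a dvd c"
proof -
  from assms(1) obtain u v where "u * a + v * b = 1" by (auto simp: comaximal_def)
  then have "c = (u * a + v * b) * c" by simp
  also have "\<dots> = a * (u * c) + (b * c) * v" by (simp add: algebra_simps)
  finally have c: "c = a * (u * c) + (b * c) * v" .
  have "a dvd a * (u * c) + (b * c) * v"
    by (rule dvd_add[OF dvd_triv_left dvd_mult2[OF assms(2)]])
  then show ?thesis using c by simp
qed

lemma comaximal_mult_dvd:
  assumes "comaximal a b" "a dvd c" "b dvd c"
  shows "a * b dvd c"
proof -
  from assms(3) obtain d where d: "c = b * d" by (rule dvdE)
  with assms have "a dvd d" using comaximal_dvd_mult by blast
  then show ?thesis by (simp add: d mult.commute[of a] mult_dvd_mono)
qed

lemma field_poly_bezout:
  fixes p q :: "'a::field poly"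
  shows "\<exists>u v. u * p + v * q dvd p \<and> u * p + v * q dvd q"
\<comment> \<open>The measure ranks \<open>q = 0\<close> strictly below nonzero constants, which
  also have degree 0, so that reaching remainder 0 counts as a descent.\<close>
proof (induction "if q = 0 then 0 else Suc (degree q)" arbitrary: p q rule: less_induct)
  case less
  show ?case
  proof (cases "q = 0")
    case True
    then show ?thesis by (intro exI[of _ 1] exI[of _ 0]) simp
  next
    case False
    have "(if p mod q = 0 then 0 else Suc (degree (p mod q))) < (if q = 0 then 0 else Suc (degree q))"
      using False degree_mod_less[OF False, of p] by auto
    from less[OF this] obtain u v where uv: "u * q + v * (p mod q) dvd q" "u * q + v * (p mod q) dvd p mod q"
      by blast
    have eq: "u * q + v * (p mod q) = v * p + (u - v * (p div q)) * q"
      by (simp add: minus_div_mult_eq_mod[symmetric] algebra_simps)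
    have "u * q + v * (p mod q) dvd p" using uv by (simp add: dvd_mod_iff)
    with uv(1) show ?thesis unfolding eq by blast
  qed
qed

subsection \<open>Reduction modulo 2 and Hensel lifting\<close>

lemma z4_cases: "(x::4) = 0 \<or> x = 1 \<or> x = 2 \<or> x = 3"
proof (cases x)
  case (of_int z)
  then have "z = 0 \<or> z = 1 \<or> z = 2 \<or> z = 3" by auto
  with of_int show ?thesis by auto
qed

lemma red2_numerals: "red2 (numeral k) = of_int (numeral k mod 4)" "red2 0 = 0" "red2 1 = 1" 
  by (simp_all add: red2_def bit0.Rep_0 bit0.Rep_1 bit0.Rep_numeral)

interpretation red2: comm_ring_hom red2
proof
  fix x y :: 4
  show "red2 (x + y) = red2 x + red2 y" "red2 (x * y) = red2 x * red2 y"
    using z4_cases[of x] z4_cases[of y] by (elim disjE; simp add: red2_numerals)+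
qed (simp_all add: red2_numerals)

interpretation red2_poly: map_poly_comm_ring_hom red2 ..

abbreviation red :: "4 poly \<Rightarrow> bit poly" where
  "red \<equiv> map_poly red2"

text \<open>A section of \<open>red2\<close> but not a homomorphism, since
  \<open>lift 1 + lift 1 = 2\<close>. It becomes additive after multiplication by 2.\<close>

definition lift :: "bit \<Rightarrow> 4" where
  "lift b = of_bit b"

lemma lift_simps [simp]: "lift 0 = 0" "lift 1 = 1"
  by (simp_all add: lift_def)

lemma red2_lift [simp]: "red2 (lift b) = b"
  by (cases b) (simp_all add: lift_def)

lemma lift_eq_0_iff [simp]: "lift b = 0 \<longleftrightarrow> b = 0"
  by (cases b) (simp_all add: lift_def)

text \<open>In Z4 the kernel {0, 2} of reduction is the annihilator of 2; by the next lemma it also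
  consists of the multiples of 2. Both descriptions carry over to polynomials
  coefficientwise.\<close>

lemma red2_eq_0_iff: "red2 a = 0 \<longleftrightarrow> 2 * a = 0"
  using z4_cases[of a] by (elim disjE) (simp_all add: red2_numerals)

lemma red2_eq_0_imp_double: "red2 a = 0 \<Longrightarrow> a = 2 * (if a = 0 then 0 else 1)"
  using z4_cases[of a] by (elim disjE) (simp_all add: red2_numerals)

lemma coeff_two_mult: "coeff (2 * f) i = 2 * coeff (f :: 'a::comm_ring_1 poly) i"
  by (simp only: mult_2 coeff_add)

lemma red_eq_0_iff: "red f = 0 \<longleftrightarrow> 2 * f = 0"
  by (simp add: poly_eq_iff red2_eq_0_iff coeff_two_mult)

lemma red_eq_0_imp_double:
  assumes "red f = 0"
  obtains g where "f = 2 * g"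
proof
  have "red2 (coeff f i) = 0" for i using assms by (metis red2.coeff_map_poly_hom coeff_0)
  then show "f = 2 * map_poly (\<lambda>a. if a = 0 then 0 else 1) f"
    using red2_eq_0_imp_double by (auto simp: poly_eq_iff coeff_two_mult coeff_map_poly)
qed

lemma red_two [simp]: "red 2 = 0"
  by (metis bit_2_eq_0 numeral_poly red2_poly.hom_numeral pCons_0_0 numeral_One one_add_one)

lemma poly_4_eq_0 [simp]: "(4 :: 4 poly) = 0"
  using red_eq_0_iff[of 2] by simp

text \<open>Lets an equation between doubles over Z4 be verified over the field with two elements,
  where lifts disappear.\<close>

lemma double_eq_iff: "2 * f = 2 * g \<longleftrightarrow> red f = red g"
  using red_eq_0_iff[of "f - g"] by (simp add: red2_poly.hom_minus right_diff_distrib)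

lemma monic_red:
  assumes "monic f"
  shows "degree (red f) = degree f" "monic (red f)"
proof -
  have c: "coeff (red f) (degree f) = 1" using assms red2.hom_one by (simp only: red2.coeff_map_poly_hom)
  show d: "degree (red f) = degree f"
    by (intro antisym degree_map_poly_le le_degree) (metis c zero_neq_one)
  show "monic (red f)" unfolding d by (rule c)
qed

abbreviation lift_poly :: "bit poly \<Rightarrow> 4 poly" where
  "lift_poly \<equiv> map_poly lift"

lemma red_lift_poly [simp]: "red (lift_poly f) = f"
  by (simp add: poly_eq_iff coeff_map_poly)

lemma degree_lift_poly [simp]: "degree (lift_poly f) = degree f"
  by (rule degree_map_poly) simp

text \<open>Lifted Bezout coefficients give 1 + 2 e instead of 1. This is a unit with inverse 1 - 2
  e because 4 = 0.\<close>

lemma comaximal_red_iff: "comaximal (red f) (red g) \<longleftrightarrow> comaximal f g"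
proof
  assume "comaximal (red f) (red g)"
  then obtain u v where "u * red f + v * red g = 1" by (auto simp: comaximal_def)
  then have "red (lift_poly u * f + lift_poly v * g - 1) = 0"
    by (simp add: red2_poly.hom_add red2_poly.hom_mult red2_poly.hom_minus)
  then obtain e where "lift_poly u * f + lift_poly v * g - 1 = 2 * e"
    by (rule red_eq_0_imp_double)
  then have e: "lift_poly u * f + lift_poly v * g = 1 + 2 * e"
    by (simp add: algebra_simps)
  have "((1 - 2 * e) * lift_poly u) * f + ((1 - 2 * e) * lift_poly v) * g
      = (1 - 2 * e) * (lift_poly u * f + lift_poly v * g)" by (simp add: algebra_simps)
  also have "\<dots> = 1" unfolding e by (simp add: algebra_simps)
  finally show "comaximal f g" by (intro comaximalI) simp
next
  assume "comaximal f g"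
  then obtain u v where "u * f + v * g = 1" by (auto simp: comaximal_def)
  then have "red u * red f + red v * red g = 1"
    by (metis red2_poly.hom_add red2_poly.hom_mult red2_poly.hom_one)
  then show "comaximal (red f) (red g)" by (rule comaximalI)
qed

text \<open>Starting from arbitrary lifts with error \<open>2 * e\<close>, corrections
  \<open>2 * a\<close> and \<open>2 * b\<close> of the factors work as soon as b g0 + a h0 = e
  modulo 2, which the Bezout identity solves. One round is exact because 4 = 0.\<close>

lemma hensel_step:
  assumes f: "monic f" "red f = g0 * h0" and g0: "monic g0" and co: "comaximal g0 h0"
  obtains g h where "f = g * h" "monic g" "red g = g0"
proof -
  define g1 where "g1 = lift_poly g0"
  define h1 where "h1 = lift_poly h0"
  have "red (f - g1 * h1) = 0"
    by (simp add: red2_poly.hom_minus red2_poly.hom_mult f g1_def h1_def)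
  then obtain e where e: "f - g1 * h1 = 2 * e" by (rule red_eq_0_imp_double)
  from co obtain u v where uv: "u * g0 + v * h0 = 1" by (auto simp: comaximal_def)
  \<comment> \<open>\<open>v * red e\<close> would already serve as \<open>a\<close>. Reducing it
    modulo \<open>g0\<close> and moving the quotient into \<open>b\<close> keeps the degree of the
    correction below that of \<open>g0\<close>, so the lifted factor stays monic.\<close>
  define a where "a = (v * red e) mod g0"
  define b where "b = u * red e + (v * red e) div g0 * h0"
  have "g0 \<noteq> 0" using g0 by auto
  then have a: "a = 0 \<or> degree a < degree g0" unfolding a_def by (rule degree_mod_less)
  have "b * g0 + a * h0 = u * red e * g0 + ((v * red e) div g0 * g0 + a) * h0"
    by (simp add: b_def algebra_simps)
  also have "\<dots> = (u * g0 + v * h0) * red e" by (simp add: a_def algebra_simps)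
  finally have ab: "b * g0 + a * h0 = red e" by (simp add: uv)
  define g where "g = g1 + 2 * lift_poly a"
  define h where "h = h1 + 2 * lift_poly b"
  have 2: "2 * (lift_poly b * g1 + lift_poly a * h1) = 2 * e"
    unfolding double_eq_iff by (simp add: red2_poly.hom_add red2_poly.hom_mult g1_def h1_def ab)
  \<comment> \<open>The product of the two corrections has the factor 4 and vanishes.\<close>
  then have "g * h = g1 * h1 + 2 * e "
    unfolding g_def h_def by (simp add: algebra_simps)
  then have 1: "f = g * h" using e by (simp add: algebra_simps)
  have dg1: "degree g1 = degree g0" "monic g1" using g0 by (simp_all add: g1_def coeff_map_poly)
  have "coeff (2 * lift_poly a) i = 0" if "i \<ge> degree g1" for i
  proof -
    have "coeff a i = 0" using a that unfolding degree_less_iff_coeff dg1(1) by blast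
    then show ?thesis by (simp add: coeff_two_mult coeff_map_poly)
  qed
  then have cg: "coeff g i = coeff g1 i" if "i \<ge> degree g1" for i using that by (simp add: g_def)
  have lg: "coeff g (degree g1) = 1" using cg[of "degree g1"] dg1(2) by (simp only: order_refl)
  have "degree g \<le> degree g1"
    by (rule degree_le) (metis cg coeff_eq_0 less_imp_le)
  moreover have "degree g1 \<le> degree g"
    by (rule le_degree) (metis lg zero_neq_one)
  ultimately have "degree g = degree g1" by (rule antisym)
  with lg have "monic g" by (simp only:)
  moreover have "red g = g0" by (simp add: g_def g1_def red2_poly.hom_add red2_poly.hom_mult)
  ultimately show ?thesis using that 1 by blast
qed

subsection \<open>Basic irreducible factors\<close>

lemma field_poly_comaximal:
  fixes p q :: "'a::field poly"
  assumes "\<And>d. d dvd p \<Longrightarrow> d dvd q \<Longrightarrow> d dvd 1"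
  shows "comaximal p q"
proof -
  obtain u v where "u * p + v * q dvd p" "u * p + v * q dvd q"
    using field_poly_bezout by blast
  with assms have "u * p + v * q dvd 1" by blast
  then obtain w where "1 = (u * p + v * q) * w" by (rule dvdE)
  then have "(w * u) * p + (w * v) * q = 1" by (simp add: algebra_simps)
  then show ?thesis by (rule comaximalI)
qed

text \<open>A repeated factor divides the derivative n x^(n-1), which is x^(n-1) modulo 2 for odd
  \<open>n\<close>. So it divides x^n as well as x^n - 1, and hence 1.\<close>

lemma xn1_squarefree:
  fixes d :: "bit poly"
  assumes "odd n" "d * d dvd xn1 n"
  shows "d dvd 1"
proof -
  from assms(2) obtain e where e: "xn1 n = d * d * e" by (rule dvdE)
  have "of_nat n = (1::bit)" using assms(1) by (metis of_nat_1 of_nat_0 even_of_nat bit_not_zero_iff even_zero)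
  then have "pderiv (xn1 n :: bit poly) = Polynomial.monom 1 (n - 1)"
    by (simp add: xn1_def pderiv_diff pderiv_monom)
  moreover have "d dvd pderiv (d * (d * e))"
    by (simp add: pderiv_mult[of d])
  ultimately have "d dvd Polynomial.monom 1 (n - 1)" using e by (simp add: mult.assoc)
  then have "d dvd Polynomial.monom 1 1 * Polynomial.monom 1 (n - 1)" by (rule dvd_mult)
  then have "d dvd Polynomial.monom 1 n" using assms(1) by (simp add: mult_monom odd_pos)
  moreover have "d dvd xn1 n" unfolding e by (simp add: mult.assoc)
  ultimately have "d dvd Polynomial.monom 1 n - xn1 n" by (rule dvd_diff)
  then show ?thesis by (simp add: xn1_def)
qed

lemma red_dvd: "f dvd g \<Longrightarrow> red f dvd red g"
  by (auto simp: dvd_def red2_poly.hom_mult)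

lemma red_xn1 [simp]: "red (xn1 n) = xn1 n"
  by (simp add: xn1_def red2_poly.hom_minus)

lemma monic_xn1: "n > 0 \<Longrightarrow> monic (xn1 n :: 'a::comm_ring_1 poly) \<and> degree (xn1 n :: 'a poly) = n"
proof -
  assume n: "n > 0"
  have c: "coeff (xn1 n :: 'a poly) i = (if i = n then 1 else if i = 0 then -1 else 0)" for i
    using n by (auto simp: xn1_def)
  have "degree (xn1 n :: 'a poly) = n"
    by (intro antisym degree_le le_degree) (auto simp: c)
  then show ?thesis by (simp add: c)
qed

text \<open>A common divisor modulo 2 would divide x^n - 1 twice; the resulting comaximality then
  lifts to Z4.\<close>

lemma comaximal_if_mult_dvd_xn1:
  fixes f g :: "4 poly"
  assumes "odd n" "f * g dvd xn1 n"
  shows "comaximal f g"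
  unfolding comaximal_red_iff[symmetric]
proof (rule field_poly_comaximal)
  fix d assume "d dvd red f" "d dvd red g"
  then have "d * d dvd red f * red g" by (rule mult_dvd_mono)
  also have "red f * red g = red (f * g)" by (simp only: red2_poly.hom_mult)
  also have "\<dots> dvd red (xn1 n)" using assms(2) by (rule red_dvd)
  finally have "d * d dvd xn1 n" by (simp only: red_xn1)
  then show "d dvd 1" by (rule xn1_squarefree[OF assms(1)])
qed

lemma basic_factorD:
  assumes "b \<in> basic_factors n"
  shows "monic b" "Factorial_Ring.irreducible (red b)" "b dvd xn1 n" "\<not> b dvd 1"
proof -
  show b: "monic b" "Factorial_Ring.irreducible (red b)" "b dvd xn1 n"
    using assms by (auto simp: basic_factors_def)
  show "\<not> b dvd 1"
  proof
    assume "b dvd 1"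
    then have "red b dvd 1" using red_dvd[of b 1] by (simp only: red2_poly.hom_one)
    with b(2) show False using Factorial_Ring.irreducible_not_unit by blast
  qed
qed

text \<open>The cofactor is monic of degree 0, hence 1.\<close>

lemma monic_dvd_antisym:
  fixes f g :: "'a::comm_ring_1 poly"
  assumes "monic f" "monic g" "f dvd g" "degree g \<le> degree f"
  shows "f = g"
proof -
  from assms(3) obtain h where h: "g = f * h" by (rule dvdE)
  with assms have "monic h" using monic_factor_comm_ring by metis
  moreover have "degree h = 0" using monic_mult_comm_ring(2)[OF assms(1) \<open>monic h\<close>] h assms(4) by simp
  ultimately have "h = 1" using monic_degree_0 by blast
  with h show ?thesis by simp
qed

text \<open>If the reductions differ, irreducibility gives comaximality modulo 2. The delicate case
  is two lifts of the same irreducible polynomial: both divide x^n - 1 only if they are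
  equal.\<close>

lemma comaximal_basic_factors:
  assumes "odd n" "a \<in> basic_factors n" "b \<in> basic_factors n" "a \<noteq> b"
  shows "comaximal a b"
proof (cases "red a dvd red b")
  case False
  have "comaximal (red a) (red b)"
  proof (rule field_poly_comaximal)
    fix d assume d: "d dvd red a" "d dvd red b"
    from d(1) obtain e where e: "red a = d * e" by (rule dvdE)
    then have "d dvd 1 \<or> e dvd 1" using basic_factorD(2)[OF assms(2)] by (auto dest: Factorial_Ring.irreducibleD)
    moreover have "red a dvd d" if "e dvd 1"
    proof -
      from that obtain k where k: "1 = e * k" by (rule dvdE)
      have "d = red a * k" unfolding e mult.assoc k[symmetric] by simp
      then show ?thesis by (rule dvdI)
    qed
    ultimately show "d dvd 1" using False d(2) dvd_trans by blast
  qed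
  then show ?thesis by (simp add: comaximal_red_iff)
next
  case True
  note a = basic_factorD[OF assms(2)] and b = basic_factorD[OF assms(3)]
  have nz: "red a \<noteq> 0" "red b \<noteq> 0" using a(2) b(2) by auto
  have "degree (red b) \<le> degree (red a)"
  proof -
    from True obtain e where e: "red b = red a * e" by (rule dvdE)
    then have "e dvd 1"
      using Factorial_Ring.irreducibleD[OF b(2)] Factorial_Ring.irreducible_not_unit[OF a(2)] by blast
    then have "degree e = 0" by (simp add: poly_dvd_1)
    then show ?thesis unfolding e using degree_mult_le[of "red a" e] by simp
  qed
  then have "red a = red b" using True monic_red(2) a(1) b(1) by (intro monic_dvd_antisym) auto
  from a(3) obtain t where t: "xn1 n = a * t" by (rule dvdE)
  then have "comaximal a t" using comaximal_if_mult_dvd_xn1[OF assms(1)] by (metis dvd_refl)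
  \<comment> \<open>Comaximality depends on the reductions alone, so it passes from \<open>a\<close>
    to \<open>b\<close>. As \<open>b\<close> divides \<open>a * t\<close>, it must divide
    \<open>a\<close>.\<close>
  then have "comaximal b t" using \<open>red a = red b\<close> comaximal_red_iff by metis
  then have "b dvd a" using b(3) t comaximal_dvd_mult by (metis mult.commute)
  moreover have "degree a = degree b" using \<open>red a = red b\<close> monic_red(1) a(1) b(1) by metis
  ultimately have "b = a" using a(1) b(1) by (intro monic_dvd_antisym) auto
  with assms(4) show ?thesis by simp
qed

text \<open>A product of pairwise comaximal elements is their least common multiple. Here this takes
  the place of unique factorization.\<close>

lemma prod_basic_factors_dvd_iff:
  assumes "odd n" "finite T" "T \<subseteq> basic_factors n"
  shows "\<Prod>T dvd f \<longleftrightarrow> (\<forall>b\<in>T. b dvd f)"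
  using assms(2,3)
proof (induction T rule: finite_induct)
  case (insert b T)
  have "comaximal c b" if "c \<in> T" for c
    by (rule comaximal_basic_factors[OF assms(1)]) (use insert.hyps insert.prems that in auto)
  then have "comaximal b (\<Prod>T)"
    by (rule comaximal_sym[OF comaximal_prod[OF insert.hyps(1)]])
  then have "b * \<Prod>T dvd f \<longleftrightarrow> b dvd f \<and> \<Prod>T dvd f"
    by (auto intro: comaximal_mult_dvd dest: dvd_mult_left dvd_mult_right)
  with insert show ?case by simp
qed simp

lemma basic_factor_dvd_prod_iff:
  assumes "odd n" "finite T" "T \<subseteq> basic_factors n" "b \<in> basic_factors n"
  shows "b dvd \<Prod>T \<longleftrightarrow> b \<in> T"
proof
  assume *: "b dvd \<Prod>T"
  show "b \<in> T"
  proof (rule ccontr)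
    assume "b \<notin> T"
    then have "comaximal (\<Prod>T) b"
      using assms by (intro comaximal_prod comaximal_basic_factors) auto
    with * have "b dvd 1" using comaximal_dvd_mult[of b "\<Prod>T" 1] comaximal_sym by auto
    with basic_factorD(4)[OF assms(4)] show False ..
  qed
qed (use assms in \<open>simp add: dvd_prod_eqI\<close>)

text \<open>A monic irreducible factor of the reduction is lifted and split off, and the cofactor
  has smaller degree. Squarefreeness modulo 2 supplies the comaximality that the lifting
  requires.\<close>

lemma monic_divisor_factorization:
  assumes "odd n" "monic f" "f dvd xn1 n"
  shows "\<exists>S. finite S \<and> S \<subseteq> basic_factors n \<and> f = \<Prod>S"
  using assms(2,3)
proof (induction "degree f" arbitrary: f rule: less_induct)
  case less
  show ?case
  proof (cases "degree f = 0")
    case True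
    then have "f = 1" using monic_degree_0 less(2) by blast
    then show ?thesis by (intro exI[of _ "{}"]) simp
  next
    case False
    then have "degree (red f) > 0" using monic_red(1) less(2) by simp
    then obtain g0 h0 where gh0: "irreducible g0" "red f = g0 * h0" "monic g0"
      using irreducible_monic_factor by blast
    have "comaximal g0 h0"
    proof (rule field_poly_comaximal)
      fix d assume "d dvd g0" "d dvd h0"
      then have "d * d dvd red f" unfolding gh0 by (rule mult_dvd_mono)
      also have "\<dots> dvd xn1 n" using red_dvd[OF less(3)] by (simp only: red_xn1)
      finally show "d dvd 1" by (rule xn1_squarefree[OF assms(1)])
    qed
    from hensel_step[OF less(2) gh0(2,3) this]
    obtain g h where gh: "f = g * h" "monic g" "red g = g0" by blast
    have h: "monic h" using gh less(2) monic_factor_comm_ring by blast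
    have dvd: "g dvd xn1 n" "h dvd xn1 n" using less(3) gh(1) by (auto dest: dvd_mult_left dvd_mult_right)
    have g: "g \<in> basic_factors n"
      using gh gh0 dvd by (simp add: basic_factors_def)
    have "degree g \<noteq> 0" using monic_degree_0[OF gh(2)] basic_factorD(4)[OF g] by auto
    then have "degree h < degree f" unfolding gh(1) monic_mult_comm_ring(2)[OF gh(2) h] by simp
    from less(1)[OF this h dvd(2)] obtain S where S: "finite S" "S \<subseteq> basic_factors n" "h = \<Prod>S"
      by blast
    \<comment> \<open>The factors are collected in a set, so a repeated factor would be lost;
      comaximality of \<open>g\<close> and \<open>h\<close> excludes repetition.\<close>
    have "g \<notin> S"
    proof
      assume "g \<in> S"
      then have "g dvd h" using S by (simp add: dvd_prod_eqI)
      moreover have "comaximal g h" using less(3) gh(1) comaximal_if_mult_dvd_xn1[OF assms(1)] by blast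
      ultimately have "g dvd 1" using comaximal_dvd_mult[of g h 1] by simp
      with basic_factorD(4)[OF g] show False ..
    qed
    then show ?thesis using S g gh by (intro exI[of _ "insert g S"]) simp
  qed
qed

lemma finite_basic_factors:
  assumes "odd n"
  shows "finite (basic_factors n)"
proof -
  have "monic (xn1 n :: 4 poly)" by (rule conjunct1[OF monic_xn1[OF odd_pos[OF assms]]])
  from monic_divisor_factorization[OF assms this dvd_refl]
  obtain S where S: "finite S" "S \<subseteq> basic_factors n" "xn1 n = \<Prod>S" by blast
  have "basic_factors n \<subseteq> S"
  proof
    fix b assume b: "b \<in> basic_factors n"
    then have "b dvd \<Prod>S" using basic_factorD(3) unfolding S(3)[symmetric] by blast
    then show "b \<in> S" using basic_factor_dvd_prod_iff[OF assms S(1,2) b] by simp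
  qed
  with S(1) show ?thesis by (rule finite_subset[rotated])
qed

text \<open>Brings any monic divisor into the shape in which \<open>lcm_xn1\<close> and
  \<open>gcd_xn1\<close> are defined.\<close>

lemma monic_divisor_eq_prod:
  assumes "odd n" "monic f" "f dvd xn1 n"
  shows "f = \<Prod>{b \<in> basic_factors n. b dvd f}"
proof -
  from monic_divisor_factorization[OF assms]
  obtain S where S: "finite S" "S \<subseteq> basic_factors n" "f = \<Prod>S" by blast
  have "{b \<in> basic_factors n. b dvd f} = S"
    using basic_factor_dvd_prod_iff[OF assms(1) S(1,2)] S(2) unfolding S(3) by auto
  with S(3) show ?thesis by (simp only:)
qed

section \<open>Lcm, gcd and cofactors through sets of basic factors\<close>

lemma monic_prod_comm_ring:
  fixes S :: "'a::comm_ring_1 poly set"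
  assumes "\<And>f. f \<in> S \<Longrightarrow> monic f"
  shows "monic (\<Prod>S)"
  using assms by (induction S rule: infinite_finite_induct) (auto intro: monic_mult_comm_ring)

text \<open>All three divisibilities are decided on basic factors. The polynomial \<open>k\<close>
  is arbitrary, since it will be a codeword polynomial or its double, neither of which need be monic
  or divide x^n - 1.\<close>

lemma lcm_xn1_dvd_iff:
  assumes "odd n" "monic f" "f dvd xn1 n" "monic g" "g dvd xn1 n"
  shows "lcm_xn1 n f g dvd k \<longleftrightarrow> f dvd k \<and> g dvd k"
proof -
  note fin = finite_basic_factors[OF assms(1)] and iff = prod_basic_factors_dvd_iff[OF assms(1)]
  have "f dvd k \<longleftrightarrow> (\<forall>b \<in> {b \<in> basic_factors n. b dvd f}. b dvd k)"
    by (subst monic_divisor_eq_prod[OF assms(1-3)], rule iff) (use fin in auto)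
  moreover have "g dvd k \<longleftrightarrow> (\<forall>b \<in> {b \<in> basic_factors n. b dvd g}. b dvd k)"
    by (subst monic_divisor_eq_prod[OF assms(1,4,5)], rule iff) (use fin in auto)
  moreover have "lcm_xn1 n f g dvd k \<longleftrightarrow> (\<forall>b \<in> {b \<in> basic_factors n. b dvd f \<or> b dvd g}. b dvd k)"
    unfolding lcm_xn1_def by (rule iff) (use fin in auto)
  ultimately show ?thesis by blast
qed

lemma monic_lcm_xn1: "monic (lcm_xn1 n f g)"
  unfolding lcm_xn1_def by (rule monic_prod_comm_ring) (auto dest: basic_factorD)

lemma monic_gcd_xn1: "monic (gcd_xn1 n f g)"
  unfolding gcd_xn1_def by (rule monic_prod_comm_ring) (auto dest: basic_factorD)

text \<open>Comaximality forbids dividing both factors. That one of them is divisible follows by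
  writing x^n - 1 as the product over the basic factors of \<open>f\<close> and those of
  \<open>g\<close>: any basic factor of it must occur in this list.\<close>

lemma basic_factor_dvd_cofactor:
  assumes "odd n" "f * g = xn1 n" "monic f" "monic g" "b \<in> basic_factors n"
  shows "b dvd f \<longleftrightarrow> \<not> b dvd g"
proof -
  have co: "comaximal f g" using comaximal_if_mult_dvd_xn1[OF assms(1)] assms(2) by (metis dvd_refl)
  show ?thesis
  proof
    assume "b dvd f"
    show "\<not> b dvd g"
    proof
      assume "b dvd g"
      with \<open>b dvd f\<close> have "b dvd 1" using co unfolding comaximal_def by (metis dvd_add dvd_mult)
      with basic_factorD(4)[OF assms(5)] show False ..
    qed
  next
    note fin = finite_basic_factors[OF assms(1)]
    have dvd: "f dvd xn1 n" "g dvd xn1 n" using assms(2) by (metis dvd_triv_left, metis dvd_triv_right)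
    let ?S = "\<lambda>f. {b \<in> basic_factors n. b dvd f}"
    have disj: "?S f \<inter> ?S g = {}"
    proof -
      have False if "c \<in> basic_factors n" "c dvd f" "c dvd g" for c
      proof -
        have "c dvd 1" using co that(2,3) unfolding comaximal_def by (metis dvd_add dvd_mult)
        with basic_factorD(4)[OF that(1)] show False ..
      qed
      then show ?thesis by blast
    qed
    have "\<Prod>(?S f \<union> ?S g) = \<Prod>(?S f) * \<Prod>(?S g)"
      by (rule prod.union_disjoint) (use fin disj in auto)
    also have "\<dots> = xn1 n"
      using assms(2) monic_divisor_eq_prod[OF assms(1,3) dvd(1)] monic_divisor_eq_prod[OF assms(1,4) dvd(2)]
      by simp
    finally have "b dvd \<Prod>(?S f \<union> ?S g)" using basic_factorD(3)[OF assms(5)] by simp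
    then have "b \<in> ?S f \<union> ?S g"
      using basic_factor_dvd_prod_iff[OF assms(1) _ _ assms(5), of "?S f \<union> ?S g"] fin by auto
    moreover assume "\<not> b dvd g"
    ultimately show "b dvd f" by simp
  qed
qed

text \<open>De Morgan's law: passing to the cofactor complements the set of basic factors, so the
  gcd of the cofactors is complementary to the lcm.\<close>

lemma lcm_mult_gcd_xn1:
  assumes "odd n" "monic f" "f * r = xn1 n" "monic f'" "f' * r' = xn1 n"
    and r: "monic r" "monic r'"
  shows "lcm_xn1 n f f' * gcd_xn1 n r r' = xn1 n"
proof -
  note fin = finite_basic_factors[OF assms(1)]
  have "{b \<in> basic_factors n. b dvd r \<and> b dvd r'} = basic_factors n - {b \<in> basic_factors n. b dvd f \<or> b dvd f'}"
    using basic_factor_dvd_cofactor[OF assms(1,3,2) r(1)] basic_factor_dvd_cofactor[OF assms(1,5,4) r(2)]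
    by auto
  then have "lcm_xn1 n f f' * gcd_xn1 n r r' = \<Prod>(basic_factors n)"
    using prod.subset_diff[of "{b \<in> basic_factors n. b dvd f \<or> b dvd f'}" "basic_factors n" "\<lambda>b. b"] fin
    unfolding lcm_xn1_def gcd_xn1_def by (simp add: mult.commute)
  also have "\<dots> = xn1 n"
  proof -
    have "monic (xn1 n :: 4 poly)" by (rule conjunct1[OF monic_xn1[OF odd_pos[OF assms(1)]]])
    from monic_divisor_eq_prod[OF assms(1) this dvd_refl]
    have "xn1 n = \<Prod>{b \<in> basic_factors n. b dvd xn1 n}" .
    moreover have "{b \<in> basic_factors n. b dvd xn1 n} = basic_factors n" using basic_factorD(3) by blast
    ultimately show ?thesis by simp
  qed
  finally show ?thesis .
qed

subsection \<open>Reciprocals and duality\<close>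

text \<open>Doubling kills the generator \<open>2 * p\<close>, which leaves a multiple of
  \<open>p * q\<close>. Conversely, after cancelling \<open>p\<close> the second condition reads q |
  2 g, and modulo 2 this makes \<open>g\<close> a multiple of \<open>q\<close>.\<close>

lemma pair_ideal_mem_iff:
  fixes p q f :: "4 poly"
  assumes "monic p" "monic q"
  shows "(\<exists>u w. f = u * (p * q) + w * (2 * p)) \<longleftrightarrow> p dvd f \<and> p * q dvd 2 * f"
proof
  assume "\<exists>u w. f = u * (p * q) + w * (2 * p)"
  then obtain u w where f: "f = u * (p * q) + w * (2 * p)" by blast
  have "f = p * (u * q + w * 2)" by (simp add: f algebra_simps)
  moreover have "2 * f = p * q * (2 * u) + 4 * (w * p)" unfolding f by (simp add: algebra_simps)
  then have "2 * f = p * q * (2 * u)" by simp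
  ultimately show "p dvd f \<and> p * q dvd 2 * f" by (metis dvd_triv_left)
next
  assume *: "p dvd f \<and> p * q dvd 2 * f"
  then obtain g where g: "f = p * g" by (auto elim: dvdE)
  have "p * q dvd p * (2 * g)" using * unfolding g by (simp only: mult.left_commute)
  then have "q dvd 2 * g" using monic_mult_dvd_cancel[OF assms(1)] by blast
  then obtain s where s: "2 * g = q * s" by (rule dvdE)
  \<comment> \<open>Over the field with two elements there are no zero divisors, so the cofactor
    \<open>s\<close> is even and \<open>g\<close> agrees with \<open>q * s'\<close> up to an even
    error.\<close>
  then have "red q * red s = 0" by (metis mult_zero_left red2_poly.hom_mult red_two)
  moreover have "red q \<noteq> 0" using monic_red(2)[OF assms(2)] by (metis coeff_0 zero_neq_one)
  ultimately have "red s = 0" by simp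
  then obtain s' where s': "s = 2 * s'" by (rule red_eq_0_imp_double)
  have "2 * (g - q * s') = 0" using s unfolding s' by (simp add: algebra_simps)
  then have "red (g - q * s') = 0" by (simp only: red_eq_0_iff)
  then obtain t where t: "g - q * s' = 2 * t" by (rule red_eq_0_imp_double)
  then have "g = q * s' + 2 * t" by (simp add: algebra_simps)
  then have "f = s' * (p * q) + t * (2 * p)" unfolding g by (simp add: algebra_simps)
  then show "\<exists>u w. f = u * (p * q) + w * (2 * p)" by blast
qed

text \<open>This is x^m f(1/x) for a fixed bound \<open>m\<close>. Unlike
  \<open>reflect_poly\<close>, which reverses at the actual degree, it is linear, and it is an
  involution on polynomials of degree at most \<open>m\<close>.\<close>

definition revp :: "nat \<Rightarrow> 'a::comm_ring_1 poly \<Rightarrow> 'a poly" where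
  "revp m f = (\<Sum>i\<le>m. Polynomial.monom (coeff f i) (m - i))"

lemma coeff_revp: "coeff (revp m f) i = (if i \<le> m then coeff f (m - i) else 0)"
proof -
  have "coeff (revp m f) i = (\<Sum>j\<le>m. if j = m - i \<and> i \<le> m then coeff f j else 0)"
    unfolding revp_def coeff_sum coeff_monom by (rule sum.cong) auto
  also have "\<dots> = (if i \<le> m then coeff f (m - i) else 0)"
    by (cases "i \<le> m") (simp_all add: sum.delta)
  finally show ?thesis .
qed

lemma degree_revp_le: "degree (revp m f) \<le> m"
  by (rule degree_le) (simp add: coeff_revp)

lemma revp_smult: "revp m (Polynomial.smult c f) = Polynomial.smult c (revp m f)"
  by (rule poly_eqI) (simp add: coeff_revp)

lemma revp_sum: "revp m (\<Sum>i\<in>A. f i) = (\<Sum>i\<in>A. revp m (f i))"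
  by (rule poly_eqI) (simp add: coeff_revp coeff_sum)

lemma revp_monom: "i \<le> m \<Longrightarrow> revp m (Polynomial.monom a i) = Polynomial.monom a (m - i)"
  by (rule poly_eqI) (auto simp: coeff_revp)

lemma revp_revp: "degree f \<le> m \<Longrightarrow> revp m (revp m f) = f"
  by (rule poly_eqI) (auto simp: coeff_revp coeff_eq_0)

lemma revp_mult:
  assumes "degree f \<le> m" "degree g \<le> k"
  shows "revp (m + k) (f * g) = revp m f * revp k g"
proof -
  let ?a = "\<lambda>i. Polynomial.monom (coeff f i)" and ?b = "\<lambda>j. Polynomial.monom (coeff g j)"
  have "f * g = (\<Sum>i\<le>m. ?a i i) * (\<Sum>j\<le>k. ?b j j)"
    using assms by (simp only: poly_as_sum_of_monoms')
  also have "\<dots> = (\<Sum>i\<le>m. \<Sum>j\<le>k. Polynomial.monom (coeff f i * coeff g j) (i + j))"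
    by (simp add: sum_product mult_monom)
  finally have "revp (m + k) (f * g)
      = (\<Sum>i\<le>m. \<Sum>j\<le>k. revp (m + k) (Polynomial.monom (coeff f i * coeff g j) (i + j)))"
    by (simp only: revp_sum)
  also have "\<dots> = (\<Sum>i\<le>m. \<Sum>j\<le>k. ?a i (m - i) * ?b j (k - j))"
    by (intro sum.cong refl) (simp add: revp_monom mult_monom)
  also have "\<dots> = revp m f * revp k g"
    by (simp add: revp_def sum_product)
  finally show ?thesis .
qed

lemma reflect_poly_eq_revp: "reflect_poly f = revp (degree f) f"
  by (rule poly_eqI) (simp add: coeff_revp coeff_reflect_poly)

lemma inv_class_ring:
  fixes a b :: "'a::comm_ring_1"
  assumes "a * b = 1"
  shows "inv\<^bsub>class_ring\<^esub> a = b"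
  using class_cring.comm_inv_char[of a b] assms by (simp add: class_ring_simps)

text \<open>The constant term of such a \<open>d\<close> divides -1, so it is a unit and
  \<open>reciprocal d\<close> is meaningful; \<open>c\<close> is its inverse.\<close>

locale monic_xn1_divisor =
  fixes n :: nat and d :: "4 poly"
  assumes n: "n > 0" and monic: "monic d" and dvd: "d dvd xn1 n"
begin

definition c where "c = inv\<^bsub>class_ring\<^esub> (coeff d 0)"

lemma c: "c * coeff d 0 = 1" "coeff d 0 * c = 1"
proof -
  obtain e where e: "xn1 n = d * e" using dvd by (rule dvdE)
  have "coeff (xn1 n :: 4 poly) 0 = -1" using n by (simp add: xn1_def)
  then have "coeff d 0 * coeff e 0 = -1" unfolding e by (simp add: coeff_mult_0)
  then have *: "coeff d 0 * (- coeff e 0) = 1" by simp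
  then have "c = - coeff e 0" unfolding c_def by (rule inv_class_ring)
  with * show "coeff d 0 * c = 1" by simp
  then show "c * coeff d 0 = 1" by (simp add: mult.commute)
qed

lemma reciprocal_eq: "reciprocal d = Polynomial.smult c (revp (degree d) d)"
  by (simp add: reciprocal_def c_def reflect_poly_eq_revp)

lemma revp_eq: "revp (degree d) d = Polynomial.smult (coeff d 0) (reciprocal d)"
  by (simp add: reciprocal_eq c)

lemma degree_reciprocal: "degree (reciprocal d) = degree d"
proof (rule antisym)
  have top: "coeff (reciprocal d) (degree d) = 1" by (simp add: reciprocal_eq coeff_revp c)
  show "degree d \<le> degree (reciprocal d)" by (rule le_degree) (simp only: top one_neq_zero not_False_eq_True)
  show "degree (reciprocal d) \<le> degree d"
    unfolding reciprocal_eq by (rule order_trans[OF degree_smult_le degree_revp_le])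
qed

lemma monic_reciprocal: "monic (reciprocal d)"
  unfolding degree_reciprocal by (simp add: reciprocal_eq coeff_revp c)

lemma revp_reciprocal: "revp (degree d) (reciprocal d) = Polynomial.smult c d"
  by (simp add: reciprocal_eq revp_smult revp_revp)

lemma dvd_revp:
  assumes "degree f \<le> m"
  shows "d dvd f \<Longrightarrow> reciprocal d dvd revp m f" "reciprocal d dvd f \<Longrightarrow> d dvd revp m f"
proof -
  assume "d dvd f"
  then obtain s where s: "f = d * s" by (rule dvdE)
  show "reciprocal d dvd revp m f"
  proof (cases "s = 0")
    case False
    then have "degree d + degree s \<le> m" using degree_monic_mult[OF monic] assms s by simp
    \<comment> \<open>Splitting \<open>m\<close> this way reverses \<open>d\<close> at its exact
      degree, while the cofactor absorbs the slack \<open>k\<close>.\<close>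
    then obtain k where k: "m = degree d + k" "degree s \<le> k" by (auto simp: le_iff_add)
    then have "revp m f = revp (degree d) d * revp k s" unfolding s by (simp add: revp_mult)
    also have "\<dots> = reciprocal d * Polynomial.smult (coeff d 0) (revp k s)" by (simp add: revp_eq)
    finally show ?thesis by (rule dvdI)
  qed (simp add: s revp_def)
next
  assume "reciprocal d dvd f"
  then obtain s where s: "f = reciprocal d * s" by (rule dvdE)
  show "d dvd revp m f"
  proof (cases "s = 0")
    case False
    then have "degree d + degree s \<le> m"
      using degree_monic_mult[OF monic_reciprocal] assms s degree_reciprocal by simp
    then obtain k where k: "m = degree d + k" "degree s \<le> k" by (auto simp: le_iff_add)
    then have "revp m f = revp (degree d) (reciprocal d) * revp k s" unfolding s
      by (simp add: revp_mult degree_reciprocal)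
    also have "\<dots> = d * Polynomial.smult c (revp k s)" by (simp add: revp_reciprocal)
    finally show ?thesis by (rule dvdI)
  qed (simp add: s revp_def)
qed

lemma dvd_revp_iff: "degree f \<le> m \<Longrightarrow> d dvd revp m f \<longleftrightarrow> reciprocal d dvd f"
  using dvd_revp(1)[OF degree_revp_le[of m f]] dvd_revp(2)[of f m] revp_revp[of f m] by auto

end

lemma reciprocal_mult:
  assumes "n > 0" "monic d" "monic e" "d * e dvd xn1 n"
  shows "reciprocal (d * e) = reciprocal d * reciprocal e"
proof -
  interpret d: monic_xn1_divisor n d by standard (use assms dvd_mult_left in auto)
  interpret e: monic_xn1_divisor n e by standard (use assms dvd_mult_right in auto)
  note de = monic_mult_comm_ring[OF assms(2,3)]
  interpret de: monic_xn1_divisor n "d * e" by standard (use assms de in auto)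
  have "coeff (d * e) 0 * (d.c * e.c) = (coeff d 0 * d.c) * (coeff e 0 * e.c)"
    by (simp add: coeff_mult_0 ac_simps)
  then have "coeff (d * e) 0 * (d.c * e.c) = 1" by (simp add: d.c e.c)
  then have "de.c = d.c * e.c" unfolding de.c_def by (rule inv_class_ring)
  then show ?thesis
    by (simp add: d.reciprocal_eq e.reciprocal_eq de.reciprocal_eq de revp_mult mult.commute)
qed

text \<open>Reversal gives 1 - x^n, and normalizing by the constant term -1 restores the sign. Hence
  reciprocals of a factorization of x^n - 1 factor it again.\<close>

lemma reciprocal_xn1:
  assumes "n > 0"
  shows "reciprocal (xn1 n) = xn1 n"
proof -
  note X = monic_xn1[OF assms, where 'a=4]
  interpret X: monic_xn1_divisor n "xn1 n" by standard (use assms X in auto)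
  have "coeff (xn1 n :: 4 poly) 0 * (-1) = 1" using assms by (simp add: xn1_def)
  then have "X.c = -1" unfolding X.c_def by (rule inv_class_ring)
  then have "reciprocal (xn1 n) = - revp n (xn1 n)" using X by (simp add: X.reciprocal_eq)
  also have "\<dots> = xn1 n"
    using assms by (intro poly_eqI) (auto simp: coeff_revp xn1_def)
  finally show ?thesis .
qed

section \<open>Words as polynomials, inner products and dual codes\<close>

lemma coeff_code_poly: "coeff (code_poly c) i = (if i < dim_vec c then c $ i else 0)"
  by (simp add: code_poly_def coeff_sum sum.delta)

lemma code_poly_inject:
  assumes "dim_vec c = dim_vec d" "code_poly c = code_poly d"
  shows "c = d"
proof (rule eq_vecI)
  fix i assume "i < dim_vec d"
  then show "c $ i = d $ i" using arg_cong[OF assms(2), of "\<lambda>f. coeff f i"] assms(1)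
    by (simp add: coeff_code_poly)
qed (rule assms(1))

lemma degree_code_poly_less: "dim_vec c = n \<Longrightarrow> n > 0 \<Longrightarrow> degree (code_poly c) < n"
  using degree_less_iff_coeff[of "code_poly c" n] by (auto simp: coeff_code_poly)

lemma code_poly_vec_coeff:
  assumes "r = 0 \<or> degree r < n"
  shows "code_poly (vec n (coeff r)) = r"
  using assms unfolding degree_less_iff_coeff by (intro poly_eqI) (auto simp: coeff_code_poly not_less)

text \<open>Write f = x^n g - g. The bound 2 n - 2, attained by products of two polynomials of
  degree below \<open>n\<close>, forces deg g to be at most n - 2 for nonzero g, so neither summand
  reaches the coefficient n - 1.\<close>

lemma xn1_dvd_imp_coeff_eq_0:
  fixes f :: "'a::comm_ring_1 poly"
  assumes "n > 0" "xn1 n dvd f" "degree f \<le> 2 * n - 2"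
  shows "coeff f (n - 1) = 0"
proof -
  from assms(2) obtain g where g: "f = xn1 n * g" by (rule dvdE)
  have gt: "coeff g (n - 1) = 0"
  proof (cases "g = 0")
    case False
    then have "n + degree g \<le> 2 * n - 2"
      using degree_monic_mult[OF _ False, of "xn1 n"] monic_xn1[OF assms(1), where 'a='a] assms(3)
      unfolding g by metis
    then show ?thesis using assms(1) by (intro coeff_eq_0) linarith
  qed simp
  have "f = Polynomial.monom 1 n * g - g" by (simp add: g xn1_def algebra_simps)
  then have "coeff f (n - 1) = coeff (Polynomial.monom 1 n * g) (n - 1) - coeff g (n - 1)"
    by (simp only: coeff_diff)
  also have "\<dots> = 0" using gt assms(1) by (simp add: coeff_monom_mult)
  finally show ?thesis .
qed

text \<open>Reversing one factor turns the inner product into a convolution, read off at index n -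
  1.\<close>

lemma scalar_prod_eq_coeff:
  assumes "n > 0" "h \<in> carrier_vec n" "k \<in> carrier_vec n"
  shows "h \<bullet> k = coeff (revp (n - 1) (code_poly h) * code_poly k) (n - 1)"
proof -
  have "coeff (revp (n - 1) (code_poly h) * code_poly k) (n - 1)
      = (\<Sum>i\<le>n - 1. h $ (n - 1 - i) * k $ (n - 1 - i))"
    unfolding coeff_mult using assms
    by (intro sum.cong) (auto simp: coeff_revp coeff_code_poly)
  also have "\<dots> = (\<Sum>i<n. h $ i * k $ i)"
    using assms(1) by (intro sum.reindex_bij_witness[of _ "\<lambda>i. n - 1 - i" "\<lambda>i. n - 1 - i"]) auto
  finally show ?thesis using assms(3) by (simp add: scalar_prod_def atLeast0LessThan)
qed

text \<open>Orthogonality to a single word controls one coefficient. Since \<open>J\<close> is an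
  ideal, all shifts of the word are available, and they control every coefficient of the remainder
  modulo x^n - 1.\<close>

lemma dual_code_mem_iff:
  fixes J :: "'a::comm_ring_1 poly set"
  assumes n: "n > 0"
    and J: "\<And>f g. f \<in> J \<Longrightarrow> g \<in> J \<Longrightarrow> f + g \<in> J" "\<And>f g. f \<in> J \<Longrightarrow> g * f \<in> J" "xn1 n \<in> J"
    and h: "h \<in> carrier_vec n"
  shows "h \<in> dual_code n {c \<in> carrier_vec n. code_poly c \<in> J}
    \<longleftrightarrow> (\<forall>k\<in>J. xn1 n dvd revp (n - 1) (code_poly h) * k)"
proof
  let ?h = "revp (n - 1) (code_poly h)"
  note X = monic_xn1[OF n, where 'a='a]
  have deg: "degree (?h * k) \<le> 2 * n - 2" if "k = 0 \<or> degree k < n" for k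
    using degree_mult_le[of ?h k] degree_revp_le[of "n - 1" "code_poly h"] that n by auto
  {
    assume *: "\<forall>k\<in>J. xn1 n dvd ?h * k"
    show "h \<in> dual_code n {c \<in> carrier_vec n. code_poly c \<in> J}"
      unfolding dual_code_def
    proof (intro CollectI conjI ballI h)
      fix k assume k: "k \<in> {c \<in> carrier_vec n. code_poly c \<in> J}"
      then have "degree (code_poly k) < n" using degree_code_poly_less[of k n] n by auto
      then have "coeff (?h * code_poly k) (n - 1) = 0"
        using * k by (intro xn1_dvd_imp_coeff_eq_0 n deg) auto
      then show "h \<bullet> k = 0" using scalar_prod_eq_coeff[OF n h] k by simp
    qed
  }
  {
    assume *: "h \<in> dual_code n {c \<in> carrier_vec n. code_poly c \<in> J}"
    show "\<forall>k\<in>J. xn1 n dvd ?h * k"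
    proof
      fix k assume k: "k \<in> J"
      obtain g r where gr: "?h * k = xn1 n * g + r" "r = 0 \<or> degree r < n"
        using monic_division[of "xn1 n" "?h * k"] X by metis
      have "coeff r m = 0" if m: "m < n" for m
      proof -
        \<comment> \<open>Multiplying by x^(n-1-m) moves coefficient \<open>m\<close> of the
          remainder \<open>r\<close> to position n - 1, where inner products are read off;
          \<open>s\<close> is the shifted \<open>k\<close> reduced to a codeword.\<close>
        let ?x = "Polynomial.monom 1 (n - 1 - m) :: 'a poly"
        obtain q s where qs: "?x * k = xn1 n * q + s" "s = 0 \<or> degree s < n"
          using monic_division[of "xn1 n" "?x * k"] X by metis
        have "s = ?x * k + (- q) * xn1 n" using qs(1) by (simp add: algebra_simps)
        then have "s \<in> J" using J k by metis
        then have "vec n (coeff s) \<in> {c \<in> carrier_vec n. code_poly c \<in> J}"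
          using code_poly_vec_coeff[OF qs(2)] by simp
        then have "h \<bullet> vec n (coeff s) = 0" using * unfolding dual_code_def by blast
        then have 0: "coeff (?h * s) (n - 1) = 0"
          using scalar_prod_eq_coeff[OF n h, of "vec n (coeff s)"] code_poly_vec_coeff[OF qs(2)] by simp
        \<comment> \<open>Both terms are congruent to \<open>?h * ?x * k\<close> modulo x^n - 1, so
          their coefficients at n - 1 agree.\<close>
        have "?x * r - ?h * s = xn1 n * (?h * q - ?x * g)"
        proof -
          have r: "r = ?h * k - xn1 n * g" and s: "s = ?x * k - xn1 n * q" using gr qs by simp_all
          show ?thesis unfolding r s by (simp add: algebra_simps)
        qed
        then have "xn1 n dvd ?x * r - ?h * s" by simp
        moreover have "degree (?x * r) \<le> 2 * n - 2"
        proof (cases "r = 0")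
          case False
          then have "degree (?x * r) \<le> (n - 1 - m) + (n - 1)"
            using degree_mult_le[of ?x r] degree_monom_le[of "1::'a" "n - 1 - m"] gr(2) by linarith
          then show ?thesis by linarith
        qed simp
        ultimately have "coeff (?x * r - ?h * s) (n - 1) = 0"
          by (intro xn1_dvd_imp_coeff_eq_0 n degree_diff_le deg[OF qs(2)])
        moreover have "coeff (?x * r) (n - 1) = coeff r m" using m by (simp add: coeff_monom_mult)
        ultimately show ?thesis using 0 by simp
      qed
      then have "r = 0" using gr(2) by (metis leading_coeff_0_iff)
      then show "xn1 n dvd ?h * k" using gr(1) by simp
    qed
  }
qed

lemma revp_double: "revp m (2 * f) = 2 * revp m f"
  by (rule poly_eqI) (simp add: coeff_revp coeff_two_mult)

text \<open>It suffices to test the generators \<open>p * q\<close> and \<open>2 * p\<close>.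
  Cancelling \<open>p * q\<close>, respectively \<open>p\<close>, from x^n - 1 leaves conditions on
  the reversed word, which reversal turns into conditions on the word itself with
  reciprocals.\<close>

lemma dual_pair_code:
  fixes p q r :: "4 poly"
  assumes n: "n > 0" and m: "monic p" "monic q" "monic r" and pqr: "p * q * r = xn1 n"
    and h: "h \<in> carrier_vec n"
  shows "h \<in> dual_code n {c \<in> carrier_vec n. p dvd code_poly c \<and> p * q dvd 2 * code_poly c}
    \<longleftrightarrow> reciprocal r dvd code_poly h \<and> reciprocal r * reciprocal q dvd 2 * code_poly h"
proof -
  let ?J = "{f. p dvd f \<and> p * q dvd 2 * f}" and ?h = "revp (n - 1) (code_poly h)"
  note pair = pair_ideal_mem_iff[OF m(1,2)]
  note qr = monic_mult_comm_ring[OF m(2,3)] and pq = monic_mult_comm_ring[OF m(1,2)]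
  have deg: "degree (code_poly h) \<le> n - 1" using degree_code_poly_less[of h n] n h by auto
  then have deg2: "degree (2 * code_poly h) \<le> n - 1"
    by (metis degree_add_le mult_2)
  have dvd: "r dvd xn1 n" "q * r dvd xn1 n"
    by (simp_all add: pqr[symmetric] mult.assoc)
  interpret r: monic_xn1_divisor n r by standard (use n m dvd in auto)
  interpret qr: monic_xn1_divisor n "q * r" by standard (use n qr dvd in auto)
  have "h \<in> dual_code n {c \<in> carrier_vec n. code_poly c \<in> ?J} \<longleftrightarrow> (\<forall>k\<in>?J. xn1 n dvd ?h * k)"
  proof (rule dual_code_mem_iff[OF n _ _ _ h])
    fix f g assume f: "f \<in> ?J"
    show "g * f \<in> ?J" using f by (auto simp: mult.left_commute[of 2 g])
    assume g: "g \<in> ?J"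
    show "f + g \<in> ?J" using f g by (auto simp: distrib_left)
  next
    have "xn1 n = p * (q * r)" "2 * xn1 n = p * q * (2 * r)" by (simp_all add: pqr[symmetric] ac_simps)
    then show "xn1 n \<in> ?J" by (metis (mono_tags, lifting) mem_Collect_eq dvd_triv_left)
  qed
  also have "\<dots> \<longleftrightarrow> xn1 n dvd ?h * (p * q) \<and> xn1 n dvd ?h * (2 * p)"
  proof
    assume *: "\<forall>k\<in>?J. xn1 n dvd ?h * k"
    have "p * q \<in> ?J" using pair[of "p * q"] by (intro CollectI) (metis add_0_right mult_1 mult_zero_left)
    moreover have "2 * p \<in> ?J" using pair[of "2 * p"] by (intro CollectI) (metis add_0 mult_1 mult_zero_left)
    ultimately show "xn1 n dvd ?h * (p * q) \<and> xn1 n dvd ?h * (2 * p)" using * by blast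
  next
    assume *: "xn1 n dvd ?h * (p * q) \<and> xn1 n dvd ?h * (2 * p)"
    show "\<forall>k\<in>?J. xn1 n dvd ?h * k"
    proof
      fix k assume "k \<in> ?J"
      then obtain u w where "k = u * (p * q) + w * (2 * p)" using pair[of k] by blast
      then have "?h * k = u * (?h * (p * q)) + w * (?h * (2 * p))" by (simp add: algebra_simps)
      then show "xn1 n dvd ?h * k" using * by (metis dvd_add dvd_mult)
    qed
  qed
  also have "xn1 n dvd ?h * (p * q) \<longleftrightarrow> r dvd ?h"
    unfolding pqr[symmetric] mult.commute[of ?h] by (rule monic_mult_dvd_cancel[OF pq(1)])
  also have "xn1 n dvd ?h * (2 * p) \<longleftrightarrow> q * r dvd 2 * ?h"
  proof -
    have "?h * (2 * p) = p * (2 * ?h)" by (simp add: ac_simps)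
    then show ?thesis unfolding pqr[symmetric] mult.assoc using monic_mult_dvd_cancel[OF m(1)] by metis
  qed
  also have "r dvd ?h \<longleftrightarrow> reciprocal r dvd code_poly h"
    by (rule r.dvd_revp_iff[OF deg])
  also have "q * r dvd 2 * ?h \<longleftrightarrow> reciprocal (q * r) dvd 2 * code_poly h"
    unfolding revp_double[symmetric] by (rule qr.dvd_revp_iff[OF deg2])
  also have "reciprocal (q * r) = reciprocal r * reciprocal q"
    using reciprocal_mult[OF n m(2,3) dvd(2)] by (simp add: mult.commute)
  finally show ?thesis by simp
qed

subsection \<open>Generated codes as ideals\<close>

lemma ring_class_ring: "ring (class_ring :: 'a::comm_ring_1 ring)"
  by (rule class_ring.ring_axioms)

lemma ideal_class_ring_iff:
  fixes I :: "'a::comm_ring_1 set"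
  shows "ideal I class_ring \<longleftrightarrow>
    0 \<in> I \<and> (\<forall>a\<in>I. \<forall>b\<in>I. a + b \<in> I) \<and> (\<forall>a\<in>I. \<forall>x. x * a \<in> I)"
proof
  assume "ideal I class_ring"
  then interpret ideal I class_ring .
  show "0 \<in> I \<and> (\<forall>a\<in>I. \<forall>b\<in>I. a + b \<in> I) \<and> (\<forall>a\<in>I. \<forall>x. x * a \<in> I)"
    using zero_closed a_closed I_l_closed by (simp add: class_ring_simps)
next
  assume I: "0 \<in> I \<and> (\<forall>a\<in>I. \<forall>b\<in>I. a + b \<in> I) \<and> (\<forall>a\<in>I. \<forall>x. x * a \<in> I)"
  show "ideal I class_ring"
  proof (rule idealI[OF ring_class_ring])
    show "subgroup I (add_monoid class_ring)"
    proof (rule group.subgroupI[OF abelian_group.a_group[OF ring.is_abelian_group[OF ring_class_ring]]])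
      fix a assume "a \<in> I"
      moreover have "\<ominus>\<^bsub>class_ring\<^esub> a = - 1 * a" by (simp add: class_ring_simps)
      ultimately show "inv\<^bsub>add_monoid class_ring\<^esub> a \<in> I" using I unfolding a_inv_def by metis
    qed (use I in auto)
  next
    fix a x assume "a \<in> I"
    then have "x * a \<in> I" using I by blast
    then show "x \<otimes>\<^bsub>class_ring\<^esub> a \<in> I" "a \<otimes>\<^bsub>class_ring\<^esub> x \<in> I"
      by (simp_all add: mult.commute)
  qed
qed

lemma ideal_Idl: "ideal (Idl\<^bsub>class_ring\<^esub> S) (class_ring :: 'a::comm_ring_1 ring)"
  by (rule ring.genideal_ideal[OF ring_class_ring]) simp

lemma Idl_subset: "S \<subseteq> Idl\<^bsub>class_ring\<^esub> (S :: 'a::comm_ring_1 set)"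
  by (rule ring.genideal_self[OF ring_class_ring]) simp

lemma Idl_minimal: "ideal I class_ring \<Longrightarrow> S \<subseteq> I \<Longrightarrow> Idl\<^bsub>class_ring\<^esub> (S :: 'a::comm_ring_1 set) \<subseteq> I"
  by (rule ring.genideal_minimal[OF ring_class_ring])

lemma PIdl_class_ring: "PIdl\<^bsub>class_ring\<^esub> (a :: 'a::comm_ring_1) = {x. a dvd x}"
  by (auto simp: cgenideal_def dvd_def mult.commute)

lemma ideal_PIdl: "ideal (PIdl\<^bsub>class_ring\<^esub> a) (class_ring :: 'a::comm_ring_1 ring)"
  by (rule cring.cgenideal_ideal[OF class_cring.cring_axioms]) simp

lemma mem_cyc_class_iff: "g \<in> cyc_class n f \<longleftrightarrow> xn1 n dvd g - f"
proof -
  have "g \<in> cyc_class n f \<longleftrightarrow> (\<exists>h. xn1 n dvd h \<and> g = h + f)"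
    unfolding cyc_class_def a_r_coset_def' PIdl_class_ring by auto
  also have "\<dots> \<longleftrightarrow> xn1 n dvd g - f" by (metis add_diff_cancel diff_add_cancel)
  finally show ?thesis .
qed

lemma cyc_class_eq_iff: "cyc_class n f = cyc_class n g \<longleftrightarrow> xn1 n dvd f - g"
proof
  have "f \<in> cyc_class n f" by (simp add: mem_cyc_class_iff)
  moreover assume "cyc_class n f = cyc_class n g"
  ultimately show "xn1 n dvd f - g" by (simp add: mem_cyc_class_iff)
next
  assume fg: "xn1 n dvd f - g"
  have "xn1 n dvd h - f \<longleftrightarrow> xn1 n dvd h - g" for h
    using dvd_add_left_iff[OF fg, of "h - f"] by simp
  then show "cyc_class n f = cyc_class n g" by (simp add: set_eq_iff mem_cyc_class_iff)
qed

text \<open>Correspondence of ideals under the quotient map; \<open>xn1 n\<close> joins the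
  generators so that the ideal upstairs contains the kernel. Images and preimages of ideals give the
  two inclusions.\<close>

lemma Idl_cyc_ring:
  fixes G :: "'a::comm_ring_1 poly set"
  shows "Idl\<^bsub>cyc_ring n\<^esub> (cyc_class n ` G) = cyc_class n ` (Idl\<^bsub>class_ring\<^esub> (insert (xn1 n) G))"
proof
  let ?I = "PIdl\<^bsub>class_ring\<^esub> (xn1 n :: 'a poly)" and ?J = "Idl\<^bsub>class_ring\<^esub> (insert (xn1 n) G)"
  have I: "ideal ?I class_ring" by (rule ideal_PIdl)
  have cls: "cyc_class n = a_r_coset class_ring ?I" by (simp add: cyc_class_def fun_eq_iff)
  interpret hom: ring_hom_ring class_ring "cyc_ring n" "cyc_class n :: 'a poly \<Rightarrow> _"
    unfolding cls cyc_ring_def by (rule ideal.rcos_ring_hom_ring[OF I])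
  have "ideal (cyc_class n ` ?J) (cyc_ring n)"
    unfolding cls cyc_ring_def by (rule ring.ring_ideal_imp_quot_ideal[OF ring_class_ring I ideal_Idl])
  moreover have "cyc_class n ` G \<subseteq> cyc_class n ` ?J" using Idl_subset[of "insert (xn1 n) G"] by blast
  ultimately show "Idl\<^bsub>cyc_ring n\<^esub> (cyc_class n ` G) \<subseteq> cyc_class n ` ?J"
    by (rule hom.S.genideal_minimal)
  let ?K = "Idl\<^bsub>cyc_ring n\<^esub> (cyc_class n ` G)"
  have G: "cyc_class n ` G \<subseteq> carrier (cyc_ring n)" using hom.hom_closed by auto
  have K: "ideal ?K (cyc_ring n)" by (rule hom.S.genideal_ideal[OF G])
  have "ideal {f \<in> carrier class_ring. cyc_class n f \<in> ?K} class_ring" by (rule hom.ideal_vimage[OF K])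
  moreover have "insert (xn1 n) G \<subseteq> {f \<in> carrier class_ring. cyc_class n f \<in> ?K}"
  proof -
    have "cyc_class n (xn1 n :: 'a poly) = cyc_class n 0" by (simp add: cyc_class_eq_iff)
    also have "\<dots> = \<zero>\<^bsub>cyc_ring n\<^esub>" using hom.hom_zero by simp
    also have "\<dots> \<in> ?K" by (rule additive_subgroup.zero_closed[OF ideal.axioms(1)[OF K]])
    finally show ?thesis using hom.S.genideal_self[OF G] by auto
  qed
  ultimately have "?J \<subseteq> {f \<in> carrier class_ring. cyc_class n f \<in> ?K}" by (rule Idl_minimal)
  then show "cyc_class n ` ?J \<subseteq> ?K" by blast
qed

text \<open>Every class has exactly one representative of degree below \<open>n\<close>: division by
  x^n - 1 provides it, and a nonzero multiple of x^n - 1 has degree at least \<open>n\<close>. So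
  the quotient ring can be traded for an ideal of A[x].\<close>

lemma generated_by_iff:
  fixes G :: "'a::comm_ring_1 poly set"
  assumes n: "n > 0"
  shows "generated_by n C G \<longleftrightarrow>
    C = {c \<in> carrier_vec n. code_poly c \<in> Idl\<^bsub>class_ring\<^esub> (insert (xn1 n) G)}"
proof
  let ?J = "Idl\<^bsub>class_ring\<^esub> (insert (xn1 n) G)"
  note X = monic_xn1[OF n, where 'a='a]
  have J: "a + b \<in> ?J" "x * a \<in> ?J" if "a \<in> ?J" "b \<in> ?J" for a b x
    using ideal_Idl[of "insert (xn1 n) G"] that unfolding ideal_class_ring_iff by blast+
  have XJ: "xn1 n \<in> ?J" using Idl_subset by blast
  have inJ: "f \<in> ?J" if "xn1 n dvd f - g" "g \<in> ?J" for f g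
  proof -
    from that(1) obtain k where "f - g = xn1 n * k" by (rule dvdE)
    then have "f = g + k * xn1 n" by (simp add: algebra_simps)
    then show ?thesis using J[OF that(2)] J(2)[OF XJ XJ] by simp
  qed
  {
    assume *: "generated_by n C G"
    then have CJ: "(\<lambda>c. cyc_class n (code_poly c)) ` C = cyc_class n ` ?J" and C: "C \<subseteq> carrier_vec n"
      by (simp_all add: generated_by_def Idl_cyc_ring)
    show "C = {c \<in> carrier_vec n. code_poly c \<in> ?J}"
    proof (rule equalityI; rule subsetI)
      fix c assume c: "c \<in> C"
      then obtain g where "g \<in> ?J" "cyc_class n (code_poly c) = cyc_class n g" using CJ by blast
      then show "c \<in> {c \<in> carrier_vec n. code_poly c \<in> ?J}"
        using c C inJ unfolding cyc_class_eq_iff by blast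
    next
      fix c assume c: "c \<in> {c \<in> carrier_vec n. code_poly c \<in> ?J}"
      then obtain c' where c': "c' \<in> C" "cyc_class n (code_poly c) = cyc_class n (code_poly c')"
        using CJ by blast
      have dims: "dim_vec c = n" "dim_vec c' = n" using c c' C by auto
      from c'(2) have "xn1 n dvd code_poly c - code_poly c'" by (simp add: cyc_class_eq_iff)
      then obtain k where k: "code_poly c - code_poly c' = xn1 n * k" by (rule dvdE)
      have lt: "degree (code_poly c - code_poly c') < n"
        using degree_code_poly_less[OF dims(1) n] degree_code_poly_less[OF dims(2) n]
        by (rule degree_diff_less)
      have "k = 0"
      proof (rule ccontr)
        assume "k \<noteq> 0"
        then have "degree (xn1 n * k) = n + degree k" using degree_monic_mult X by metis
        then show False using lt k by simp
      qed
      then have eq: "code_poly c = code_poly c'" using k by simp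
      have "c = c'" using dims by (intro code_poly_inject[OF _ eq]) simp
      then show "c \<in> C" using c' by simp
    qed
  }
  {
    assume C: "C = {c \<in> carrier_vec n. code_poly c \<in> ?J}"
    have "cyc_class n f \<in> (\<lambda>c. cyc_class n (code_poly c)) ` C" if f: "f \<in> ?J" for f
    proof -
      obtain q r where qr: "f = xn1 n * q + r" "r = 0 \<or> degree r < n"
        using monic_division[of "xn1 n" f] X by metis
      have 1: "xn1 n dvd f - r" using qr(1) by simp
      then have "xn1 n dvd r - f" by (metis dvd_minus_iff minus_diff_eq)
      then have "r \<in> ?J" using f by (rule inJ)
      then have "vec n (coeff r) \<in> C" using code_poly_vec_coeff[OF qr(2)] by (simp add: C)
      moreover have "cyc_class n f = cyc_class n (code_poly (vec n (coeff r)))"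
        using 1 by (simp add: cyc_class_eq_iff code_poly_vec_coeff[OF qr(2)])
      ultimately show ?thesis by blast
    qed
    then show "generated_by n C G"
      unfolding generated_by_def Idl_cyc_ring using C by auto
  }
qed

lemma Idl_pair:
  fixes p q :: "4 poly"
  assumes "monic p" "monic q" "p * q dvd xn1 n"
  shows "Idl\<^bsub>class_ring\<^esub> {xn1 n, p * q, 2 * p} = {f. p dvd f \<and> p * q dvd 2 * f}"
proof
  let ?I = "Idl\<^bsub>class_ring\<^esub> {xn1 n, p * q, 2 * p}"
  have I: "a + b \<in> ?I" "x * a \<in> ?I" if "a \<in> ?I" "b \<in> ?I" for a b x
    using ideal_Idl[of "{xn1 n, p * q, 2 * p}"] that unfolding ideal_class_ring_iff by blast+
  have gens: "p * q \<in> ?I" "2 * p \<in> ?I" using Idl_subset[of "{xn1 n, p * q, 2 * p}"] by auto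
  show "{f. p dvd f \<and> p * q dvd 2 * f} \<subseteq> ?I"
  proof
    fix f assume "f \<in> {f. p dvd f \<and> p * q dvd 2 * f}"
    then obtain u w where "f = u * (p * q) + w * (2 * p)"
      using pair_ideal_mem_iff[OF assms(1,2), of f] by blast
    then show "f \<in> ?I" using I gens by simp
  qed
  have "ideal {f. p dvd f \<and> p * q dvd 2 * f} class_ring"
    unfolding ideal_class_ring_iff
  proof (intro conjI ballI allI)
    fix f x assume "f \<in> {f. p dvd f \<and> p * q dvd 2 * f}"
    then have "p dvd x * f" "p * q dvd x * (2 * f)" by (simp_all add: dvd_mult)
    moreover have "x * (2 * f) = 2 * (x * f)" by (rule mult.left_commute)
    ultimately show "x * f \<in> {f. p dvd f \<and> p * q dvd 2 * f}" by simp
  qed (simp_all add: distrib_left)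
  moreover have "{xn1 n, p * q, 2 * p} \<subseteq> {f. p dvd f \<and> p * q dvd 2 * f}"
  proof -
    have "p dvd xn1 n" using assms(3) by (rule dvd_mult_left)
    moreover have "2 * (2 * p) = 4 * p" by simp
    then have "2 * (2 * p) = 0" by simp
    ultimately show ?thesis using assms(3) by (simp add: dvd_mult)
  qed
  ultimately show "?I \<subseteq> {f. p dvd f \<and> p * q dvd 2 * f}" by (rule Idl_minimal)
qed

text \<open>Since \<open>v\<close> and \<open>1 - v\<close> are orthogonal idempotents, \<open>a + b v = v (a + b) + (1 - v) a\<close>; the two
  components are the images of \<open>a + b v\<close> under \<open>v \<mapsto> 1\<close> and \<open>v \<mapsto> 0\<close>.\<close>

definition at1 :: "z4v \<Rightarrow> 4" where "at1 x = const_part x + v_part x"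
definition at0 :: "z4v \<Rightarrow> 4" where "at0 x = const_part x"

interpretation at1: comm_ring_hom at1
  by standard (simp_all add: at1_def z4v_defs algebra_simps)

interpretation at0: comm_ring_hom at0
  by standard (simp_all add: at0_def z4v_defs algebra_simps)

interpretation emb: comm_ring_hom emb
  by standard (simp_all add: emb_hom)

interpretation at1_poly: map_poly_comm_ring_hom at1 ..
interpretation at0_poly: map_poly_comm_ring_hom at0 ..
interpretation emb_poly: map_poly_comm_ring_hom emb ..

lemma at_simps [simp]:
  "at1 vv = 1" "at0 vv = 0" "at1 (emb a) = a" "at0 (emb a) = a"
  by (simp_all add: at1_def at0_def vv_def emb_def)

lemma z4v_eq_iff: "x = y \<longleftrightarrow> at1 x = at1 y \<and> at0 x = at0 y"
  by (cases x; cases y) (auto simp: at1_def at0_def)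

lemma z4v_poly_eq_iff: "f = g \<longleftrightarrow> map_poly at1 f = map_poly at1 g \<and> map_poly at0 f = map_poly at0 g"
  by (auto simp: poly_eq_iff z4v_eq_iff)

lemma at_two [simp]: "at1 2 = 2" "at0 2 = 2"
  using at1.hom_numeral[of "num.Bit0 num.One"] at0.hom_numeral[of "num.Bit0 num.One"] by simp_all

lemma at_emb_poly [simp]:
  "map_poly at1 (emb_poly a f) = Polynomial.smult (at1 a) f"
  "map_poly at0 (emb_poly a f) = Polynomial.smult (at0 a) f"
  by (simp_all add: poly_eq_iff emb_poly_def at1.hom_mult at0.hom_mult)

lemma at_xn1 [simp]: "map_poly at1 (xn1 n) = xn1 n" "map_poly at0 (xn1 n) = xn1 n"
  by (simp_all add: xn1_def at1_poly.hom_minus at0_poly.hom_minus)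

lemma smult_two: "Polynomial.smult 2 f = 2 * (f :: 'a::comm_ring_1 poly)"
  by (rule poly_eqI) (simp add: coeff_two_mult)

lemma emb_poly_0: "emb_poly a 0 = 0"
  by (simp add: emb_poly_def)

lemma emb_poly_add: "emb_poly a (f + g) = emb_poly a f + emb_poly a g"
  by (simp add: emb_poly_def emb_poly.hom_add smult_add_right)

lemma emb_poly_mult: "emb_poly a (h * f) = map_poly emb h * emb_poly a f"
  by (simp add: emb_poly_def emb_poly.hom_mult)

lemma emb_poly_double: "emb_poly a (2 * f) = emb_poly (2 * a) f"
  by (simp only: mult_2 emb_poly_add) (simp only: emb_poly_def smult_add_left)

lemma emb_poly_xn1: "emb_poly a (xn1 n) = [:a:] * xn1 n"
  by (simp add: emb_poly_def xn1_def emb_poly.hom_minus)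

lemma ideal_emb_poly_vimage:
  assumes "ideal I class_ring"
  shows "ideal {f. emb_poly a f \<in> I} class_ring"
  using assms unfolding ideal_class_ring_iff mem_Collect_eq emb_poly_add emb_poly_mult emb_poly_0
  by simp

lemma ideal_vimage_poly:
  assumes "ideal I class_ring" "comm_ring_hom h"
  shows "ideal {f. h f \<in> I} class_ring"
proof -
  interpret comm_ring_hom h by fact
  show ?thesis using assms(1) unfolding ideal_class_ring_iff mem_Collect_eq hom_add hom_mult by simp
qed

lemma ideal_Int: "ideal I class_ring \<Longrightarrow> ideal J class_ring \<Longrightarrow> ideal (I \<inter> J) (class_ring :: 'a::comm_ring_1 ring)"
  by (simp add: ideal_class_ring_iff)

text \<open>Both inclusions are checked on generators: preimages of ideals under the two evaluations
  are ideals, and so are preimages under multiplication by v and by 1 - v. A polynomial is then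
  reassembled from its two evaluations.\<close>

lemma Idl_z4v:
  fixes a1 b1 a2 b2 :: "4 poly"
  shows "Idl\<^bsub>class_ring\<^esub> {xn1 n, emb_poly vv a1, emb_poly (2 * vv) b1,
       emb_poly (1 - vv) a2, emb_poly (2 * (1 - vv)) b2}
    = {f. map_poly at1 f \<in> Idl\<^bsub>class_ring\<^esub> {xn1 n, a1, 2 * b1}} \<inter>
      {f. map_poly at0 f \<in> Idl\<^bsub>class_ring\<^esub> {xn1 n, a2, 2 * b2}}" (is "Idl\<^bsub>_\<^esub> ?S = ?K1 \<inter> ?K2")
proof
  let ?I = "Idl\<^bsub>class_ring\<^esub> ?S"
  let ?S1 = "{xn1 n, a1, 2 * b1}" and ?S2 = "{xn1 n, a2, 2 * b2}"
  let ?I1 = "Idl\<^bsub>class_ring\<^esub> ?S1" and ?I2 = "Idl\<^bsub>class_ring\<^esub> ?S2"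
  have "0 \<in> ?I1" "0 \<in> ?I2"
    using ideal_Idl[of ?S1] ideal_Idl[of ?S2] unfolding ideal_class_ring_iff by simp_all
  then have "?S \<subseteq> ?K1 \<inter> ?K2"
    using Idl_subset[of ?S1] Idl_subset[of ?S2]
    by (simp add: at1.hom_minus at0.hom_minus at1.hom_mult at0.hom_mult smult_two)
  moreover have "ideal (?K1 \<inter> ?K2) class_ring"
    by (intro ideal_Int ideal_vimage_poly ideal_Idl
          at1_poly.comm_ring_hom_axioms at0_poly.comm_ring_hom_axioms)
  ultimately show "?I \<subseteq> ?K1 \<inter> ?K2" by (intro Idl_minimal)
  have I: "\<forall>f\<in>?I. \<forall>g\<in>?I. f + g \<in> ?I" "\<forall>f\<in>?I. \<forall>h. h * f \<in> ?I"
    using ideal_Idl[of ?S] unfolding ideal_class_ring_iff by simp_all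
  have gens: "xn1 n \<in> ?I" "emb_poly vv a1 \<in> ?I" "emb_poly (2 * vv) b1 \<in> ?I"
      "emb_poly (1 - vv) a2 \<in> ?I" "emb_poly (2 * (1 - vv)) b2 \<in> ?I"
    using Idl_subset[of ?S] by simp_all
  then have S: "?S1 \<subseteq> {f. emb_poly vv f \<in> ?I}" "?S2 \<subseteq> {f. emb_poly (1 - vv) f \<in> ?I}"
    using I(2) unfolding insert_subset mem_Collect_eq emb_poly_double emb_poly_xn1 by blast+
  note minimal = Idl_minimal[OF ideal_emb_poly_vimage[OF ideal_Idl]]
  from minimal[OF S(1)] minimal[OF S(2)] have "emb_poly vv (map_poly at1 f) + emb_poly (1 - vv) (map_poly at0 f) \<in> ?I"
    if "f \<in> ?K1 \<inter> ?K2" for f using that I(1) by blast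
  moreover have "f = emb_poly vv (map_poly at1 f) + emb_poly (1 - vv) (map_poly at0 f)" for f
    unfolding z4v_poly_eq_iff
    by (simp add: at1_poly.hom_add at0_poly.hom_add at1.hom_minus at0.hom_minus)
  ultimately show "?K1 \<inter> ?K2 \<subseteq> ?I" by (metis subsetI)
qed

subsection \<open>Hulls and their type\<close>

lemma code_poly_map_vec: "h 0 = 0 \<Longrightarrow> code_poly (map_vec h c) = map_poly h (code_poly c)"
  for h :: "'a::comm_ring_1 \<Rightarrow> 'b::comm_ring_1"
  by (rule poly_eqI) (simp add: coeff_code_poly coeff_map_poly)

lemma code_poly_add: "dim_vec c = dim_vec d \<Longrightarrow> code_poly (c + d) = code_poly c + code_poly d"
  by (rule poly_eqI) (simp add: coeff_code_poly)

lemma code_poly_smult: "code_poly (a \<cdot>\<^sub>v c) = Polynomial.smult a (code_poly c)"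
  by (rule poly_eqI) (simp add: coeff_code_poly)

definition v_join :: "4 vec \<Rightarrow> 4 vec \<Rightarrow> z4v vec" where
  "v_join c1 c2 = vv \<cdot>\<^sub>v map_vec emb c1 + (1 - vv) \<cdot>\<^sub>v map_vec emb c2"

lemma v_join_carrier: "c1 \<in> carrier_vec n \<Longrightarrow> c2 \<in> carrier_vec n \<Longrightarrow> v_join c1 c2 \<in> carrier_vec n"
  by (simp add: v_join_def)

lemma at_v_join:
  assumes "c1 \<in> carrier_vec n" "c2 \<in> carrier_vec n"
  shows "map_vec at1 (v_join c1 c2) = c1" "map_vec at0 (v_join c1 c2) = c2"
  using assms by (auto simp: v_join_def at1.hom_add at0.hom_add at1.hom_mult at0.hom_mult
      at1.hom_minus at0.hom_minus)

lemma z4v_vec_eq_iff: "c = d \<longleftrightarrow> map_vec at1 c = map_vec at1 d \<and> map_vec at0 c = map_vec at0 d"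
proof
  assume *: "map_vec at1 c = map_vec at1 d \<and> map_vec at0 c = map_vec at0 d"
  then have dim: "dim_vec c = dim_vec d" by (metis index_map_vec(2))
  show "c = d"
  proof (rule eq_vecI)
    fix i assume "i < dim_vec d"
    then show "c $ i = d $ i" using * dim unfolding z4v_eq_iff by (metis index_map_vec(1))
  qed (rule dim)
qed simp

lemma v_join_at: "v_join (map_vec at1 c) (map_vec at0 c) = c"
proof -
  have c: "map_vec at1 c \<in> carrier_vec (dim_vec c)" "map_vec at0 c \<in> carrier_vec (dim_vec c)" by auto
  show ?thesis unfolding z4v_vec_eq_iff at_v_join[OF c] by simp
qed

lemma v_sum_eq:
  assumes "C1 \<subseteq> carrier_vec n" "C2 \<subseteq> carrier_vec n"
  shows "v_sum C1 C2 = {c \<in> carrier_vec n. map_vec at1 c \<in> C1 \<and> map_vec at0 c \<in> C2}"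
proof (rule equalityI; rule subsetI)
  fix c assume "c \<in> v_sum C1 C2"
  then obtain c1 c2 where c: "c1 \<in> C1" "c2 \<in> C2" "c = v_join c1 c2"
    by (auto simp: v_sum_def v_join_def)
  then have "c1 \<in> carrier_vec n" "c2 \<in> carrier_vec n" using assms by auto
  then show "c \<in> {c \<in> carrier_vec n. map_vec at1 c \<in> C1 \<and> map_vec at0 c \<in> C2}"
    using c by (simp add: at_v_join v_join_carrier)
next
  fix c assume "c \<in> {c \<in> carrier_vec n. map_vec at1 c \<in> C1 \<and> map_vec at0 c \<in> C2}"
  then show "c \<in> v_sum C1 C2"
    unfolding v_sum_def using v_join_at[of c, symmetric] unfolding v_join_def by blast
qed

text \<open>An inner product vanishes iff both of its evaluations do. The zero words in
  \<open>C1\<close> and \<open>C2\<close> allow each component to be tested alone.\<close>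

lemma dual_code_v_sum:
  assumes "C1 \<subseteq> carrier_vec n" "C2 \<subseteq> carrier_vec n" "0\<^sub>v n \<in> C1" "0\<^sub>v n \<in> C2" "h \<in> carrier_vec n"
  shows "h \<in> dual_code n (v_sum C1 C2) \<longleftrightarrow>
    map_vec at1 h \<in> dual_code n C1 \<and> map_vec at0 h \<in> dual_code n C2"
proof -
  have scalar: "h \<bullet> k = 0 \<longleftrightarrow> map_vec at1 h \<bullet> map_vec at1 k = 0 \<and> map_vec at0 h \<bullet> map_vec at0 k = 0"
    if "k \<in> carrier_vec n" for k
    using that assms(5) unfolding z4v_eq_iff
    by (simp add: scalar_prod_def at1.hom_sum at0.hom_sum at1.hom_mult at0.hom_mult)
  have "h \<in> dual_code n (v_sum C1 C2) \<longleftrightarrow>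
    (\<forall>k\<in>v_sum C1 C2. map_vec at1 h \<bullet> map_vec at1 k = 0 \<and> map_vec at0 h \<bullet> map_vec at0 k = 0)"
    using assms(5) scalar unfolding dual_code_def v_sum_eq[OF assms(1,2)] by auto
  also have "\<dots> \<longleftrightarrow> (\<forall>k1\<in>C1. \<forall>k2\<in>C2. map_vec at1 h \<bullet> k1 = 0 \<and> map_vec at0 h \<bullet> k2 = 0)"
  proof
    assume *: "\<forall>k\<in>v_sum C1 C2. map_vec at1 h \<bullet> map_vec at1 k = 0 \<and> map_vec at0 h \<bullet> map_vec at0 k = 0"
    show "\<forall>k1\<in>C1. \<forall>k2\<in>C2. map_vec at1 h \<bullet> k1 = 0 \<and> map_vec at0 h \<bullet> k2 = 0"
    proof (intro ballI)
      fix k1 k2 assume k: "k1 \<in> C1" "k2 \<in> C2"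
      then have "v_join k1 k2 \<in> v_sum C1 C2" unfolding v_sum_def v_join_def by blast
      moreover have "k1 \<in> carrier_vec n" "k2 \<in> carrier_vec n" using k assms by auto
      ultimately show "map_vec at1 h \<bullet> k1 = 0 \<and> map_vec at0 h \<bullet> k2 = 0"
        using * at_v_join by metis
    qed
  qed (auto simp: v_sum_eq[OF assms(1,2)])
  also have "\<dots> \<longleftrightarrow> map_vec at1 h \<in> dual_code n C1 \<and> map_vec at0 h \<in> dual_code n C2"
    using assms(3-5) unfolding dual_code_def by auto
  finally show ?thesis .
qed

lemma hull_code_v_sum:
  assumes "C1 \<subseteq> carrier_vec n" "C2 \<subseteq> carrier_vec n" "0\<^sub>v n \<in> C1" "0\<^sub>v n \<in> C2"
  shows "hull_code n (v_sum C1 C2) =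
    {c \<in> carrier_vec n. map_vec at1 c \<in> hull_code n C1 \<and> map_vec at0 c \<in> hull_code n C2}"
proof (rule equalityI; rule subsetI)
  fix c assume "c \<in> hull_code n (v_sum C1 C2)"
  then show "c \<in> {c \<in> carrier_vec n. map_vec at1 c \<in> hull_code n C1 \<and> map_vec at0 c \<in> hull_code n C2}"
    using dual_code_v_sum[OF assms, of c] unfolding hull_code_def v_sum_eq[OF assms(1,2)] by simp
next
  fix c assume "c \<in> {c \<in> carrier_vec n. map_vec at1 c \<in> hull_code n C1 \<and> map_vec at0 c \<in> hull_code n C2}"
  then show "c \<in> hull_code n (v_sum C1 C2)"
    using dual_code_v_sum[OF assms, of c] unfolding hull_code_def v_sum_eq[OF assms(1,2)] by simp
qed

text \<open>For a = b q dividing x^n - 1 with \<open>b\<close> and \<open>q\<close> monic, this is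
  the code generated by \<open>a\<close> and \<open>2 * b\<close>, written so that intersecting
  codes means conjoining conditions.\<close>

definition pair_code :: "nat \<Rightarrow> 4 poly \<Rightarrow> 4 poly \<Rightarrow> 4 vec set" where
  "pair_code n a b = {c \<in> carrier_vec n. b dvd code_poly c \<and> a dvd 2 * code_poly c}"

lemma hull_pair_code:
  assumes "odd n" and m: "monic p" "monic q" "monic r" and pqr: "p * q * r = xn1 n"
  defines "F \<equiv> lcm_xn1 n (p * q) (reciprocal r * reciprocal q)" and "G \<equiv> lcm_xn1 n p (reciprocal r)"
    and "R \<equiv> gcd_xn1 n r (reciprocal p)"
  defines "Q \<equiv> exact_quotient (xn1 n) (R * G)"
  shows "hull_code n (pair_code n (p * q) p) = pair_code n F G" (is ?hull)
    and "F = G * Q" "G * Q * R = xn1 n" "monic G" "monic Q" "monic R"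
proof -
  have n: "n > 0" using assms(1) by (simp add: odd_pos)
  note pq = monic_mult_comm_ring[OF m(1,2)] and qr = monic_mult_comm_ring[OF m(2,3)]
  have dvd: "p dvd xn1 n" "q dvd xn1 n" "r dvd xn1 n" "q * r dvd xn1 n" "p * (q * r) dvd xn1 n"
    unfolding pqr[symmetric] by (simp_all add: mult.assoc)
  have pq_dvd: "p * q dvd xn1 n" by (rule dvdI[OF pqr[symmetric]])
  interpret p: monic_xn1_divisor n p by standard (use n m dvd in auto)
  interpret q: monic_xn1_divisor n q by standard (use n m dvd in auto)
  interpret r: monic_xn1_divisor n r by standard (use n m dvd in auto)
  \<comment> \<open>The reciprocal of p q r = x^n - 1 exhibits \<open>reciprocal p\<close> as the
    cofactor of the second argument of \<open>F\<close>.\<close>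
  have rec: "reciprocal r * reciprocal q * reciprocal p = xn1 n"
    using reciprocal_xn1[OF n] reciprocal_mult[OF n m(1) qr(1) dvd(5)] reciprocal_mult[OF n m(2,3) dvd(4)]
    unfolding pqr[symmetric] mult.assoc by (simp add: ac_simps)
  note m' = p.monic_reciprocal q.monic_reciprocal r.monic_reciprocal
  note rq' = monic_mult_comm_ring[OF m'(3,2)]
  have dvd': "reciprocal r dvd xn1 n" "reciprocal r * reciprocal q dvd xn1 n"
    unfolding rec[symmetric] by (simp add: mult.assoc, rule dvd_triv_left)
  have F: "F dvd k \<longleftrightarrow> p * q dvd k \<and> reciprocal r * reciprocal q dvd k" for k
    unfolding F_def by (rule lcm_xn1_dvd_iff[OF assms(1) pq(1) pq_dvd rq'(1) dvd'(2)])
  have G: "G dvd k \<longleftrightarrow> p dvd k \<and> reciprocal r dvd k" for k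
    unfolding G_def by (rule lcm_xn1_dvd_iff[OF assms(1) m(1) dvd(1) m'(3) dvd'(1)])
  show ?hull
    unfolding hull_code_def pair_code_def
    using dual_pair_code[OF n m pqr] F G by auto
  show mG: "monic G" and mR: "monic R" unfolding G_def R_def by (rule monic_lcm_xn1 monic_gcd_xn1)+
  have FR: "F * R = xn1 n"
    unfolding F_def R_def by (rule lcm_mult_gcd_xn1[OF assms(1) pq(1) pqr rq'(1) rec m(3) m'(1)])
  have "G dvd F" unfolding G using F[of F] by (auto dest: dvd_mult_left)
  then obtain Q' where Q': "F = G * Q'" by (rule dvdE)
  have "monic F" unfolding F_def by (rule monic_lcm_xn1)
  then have mQ': "monic Q'" using mG monic_factor_comm_ring Q' by blast
  have RG: "monic (R * G)" by (rule monic_mult_comm_ring[OF mR mG])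
  have X: "xn1 n = Q' * (R * G)" using FR Q' by (simp add: ac_simps)
  \<comment> \<open>The quotient is unique because the monic \<open>R * G\<close> can be
    cancelled.\<close>
  have "Q = Q'"
    unfolding Q_def exact_quotient_def
  proof (rule the_equality[where P = "\<lambda>q. xn1 n = q * (R * G)"])
    show "xn1 n = Q' * (R * G)" by (rule X)
  next
    fix s assume "xn1 n = s * (R * G)"
    then have "(R * G) * s = (R * G) * Q'" using X by (simp add: mult.commute)
    then show "s = Q'" using monic_mult_cancel[OF RG] by blast
  qed
  then show "F = G * Q" "G * Q * R = xn1 n" "monic Q" using Q' mQ' FR by simp_all
qed

text \<open>The second parameter can live over \<open>bit\<close> because doubling factors through
  reduction. For the same reason the map is additive, and compatible with scalars acting on
  \<open>y\<close> through \<open>red2\<close>, although \<open>lift_poly\<close> is not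
  additive.\<close>

definition pair_code_param :: "nat \<Rightarrow> 4 poly \<Rightarrow> 4 poly \<Rightarrow> 4 vec \<Rightarrow> bit vec \<Rightarrow> 4 vec" where
  "pair_code_param n a b x y =
    vec n (coeff (code_poly x * a + 2 * lift_poly (code_poly y) * b))"

lemma lift_poly_add: "2 * lift_poly (f + g) = 2 * (lift_poly f + lift_poly g)"
  unfolding double_eq_iff by (simp add: red2_poly.hom_add)

lemma lift_poly_smult: "2 * lift_poly (Polynomial.smult (red2 a) f) = 2 * Polynomial.smult a (lift_poly f)"
  unfolding double_eq_iff by (rule poly_eqI) (simp add: red2.hom_mult coeff_map_poly)

lemma pair_code_param_add:
  assumes "x \<in> carrier_vec k1" "x' \<in> carrier_vec k1" "y \<in> carrier_vec k2" "y' \<in> carrier_vec k2"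
  shows "pair_code_param n a b (x + x') (y + y') = pair_code_param n a b x y + pair_code_param n a b x' y'"
proof -
  have 1: "code_poly (x + x') = code_poly x + code_poly x'" "code_poly (y + y') = code_poly y + code_poly y'"
    using assms by (simp_all add: code_poly_add)
  have "code_poly (x + x') * a + 2 * lift_poly (code_poly (y + y')) * b
    = (code_poly x * a + 2 * lift_poly (code_poly y) * b) + (code_poly x' * a + 2 * lift_poly (code_poly y') * b)"
    unfolding 1 lift_poly_add by (simp add: algebra_simps)
  then show ?thesis unfolding pair_code_param_def by auto
qed

lemma pair_code_param_smult:
  "pair_code_param n a b (s \<cdot>\<^sub>v x) (red2 s \<cdot>\<^sub>v y) = s \<cdot>\<^sub>v pair_code_param n a b x y"
proof -
  have "code_poly (s \<cdot>\<^sub>v x) * a + 2 * lift_poly (code_poly (red2 s \<cdot>\<^sub>v y)) * b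
    = Polynomial.smult s (code_poly x * a + 2 * lift_poly (code_poly y) * b)"
    unfolding code_poly_smult lift_poly_smult by (simp add: smult_add_right)
  then show ?thesis unfolding pair_code_param_def by auto
qed

lemma degree_less_add:
  "f = 0 \<or> degree f < n \<Longrightarrow> g = 0 \<or> degree g < n \<Longrightarrow> f + g = 0 \<or> degree (f + g) < n"
  unfolding degree_less_iff_coeff by simp

lemma degree_less_diff:
  "f = 0 \<or> degree f < n \<Longrightarrow> g = 0 \<or> degree g < n \<Longrightarrow> f - g = 0 \<or> degree (f - g) < n"
  for f g :: "'a::comm_ring_1 poly"
  unfolding degree_less_iff_coeff by simp

lemma degree_less_double: "f = 0 \<or> degree f < n \<Longrightarrow> 2 * f = 0 \<or> degree (2 * f) < n"
  for f :: "'a::comm_ring_1 poly"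
  using degree_less_add[of f n f] by (simp only: mult_2)

lemma degree_less_monic_mult:
  fixes g :: "'a::comm_ring_1 poly"
  assumes "monic g" "f = 0 \<or> degree f < k"
  shows "f * g = 0 \<or> degree (f * g) < k + degree g"
proof (cases "f = 0")
  case False
  then have "degree (f * g) = degree g + degree f"
    using degree_monic_mult[OF assms(1)] by (metis mult.commute)
  with False assms(2) show ?thesis by simp
qed simp

text \<open>The degree bounds select one representative each: \<open>y\<close> is determined modulo
  2 and \<open>Q\<close>, since 2 Q G is already a multiple of the first generator, and
  \<open>x\<close> modulo \<open>R\<close>, since G Q R = x^n - 1.\<close>

lemma pair_code_param_bij:
  assumes n: "n > 0" and m: "monic G" "monic Q" "monic R" and GQR: "G * Q * R = xn1 n"
  shows "bij_betw (\<lambda>(x, y). pair_code_param n (G * Q) G x y)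
    (carrier_vec (degree R) \<times> carrier_vec (degree Q)) (pair_code n (G * Q) G)"
proof -
  let ?P = "\<lambda>x y. code_poly x * (G * Q) + 2 * lift_poly (code_poly y) * G"
  note GQ = monic_mult_comm_ring[OF m(1,2)]
  have "degree (xn1 n :: 4 poly) = n" using monic_xn1[OF n] by blast
  then have n_eq: "degree R + degree (G * Q) = n" using monic_mult_comm_ring(2)[OF GQ(1) m(3)] GQR by simp
  have cp: "code_poly x = 0 \<or> degree (code_poly x) < k" if "x \<in> carrier_vec k" for k and x :: "'a::comm_ring_1 vec"
    unfolding degree_less_iff_coeff using that by (simp add: coeff_code_poly)
  have lp: "lift_poly f = 0 \<or> degree (lift_poly f) < k" if "f = 0 \<or> degree f < k" for f k
    using that by auto
  have deg: "?P x y = 0 \<or> degree (?P x y) < n"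
    if "x \<in> carrier_vec (degree R)" "y \<in> carrier_vec (degree Q)" for x y
  proof (rule degree_less_add)
    show "code_poly x * (G * Q) = 0 \<or> degree (code_poly x * (G * Q)) < n"
      using degree_less_monic_mult[OF GQ(1) cp[OF that(1)]] n_eq by simp
    have "degree Q + degree G \<le> n" using n_eq GQ(2) by simp
    then show "2 * lift_poly (code_poly y) * G = 0 \<or> degree (2 * lift_poly (code_poly y) * G) < n"
      using degree_less_monic_mult[OF m(1) degree_less_double[OF lp[OF cp[OF that(2)]]]] by auto
  qed
  have code: "code_poly (pair_code_param n (G * Q) G x y) = ?P x y"
    if "x \<in> carrier_vec (degree R)" "y \<in> carrier_vec (degree Q)" for x y
    unfolding pair_code_param_def by (rule code_poly_vec_coeff[OF deg[OF that]])
  have mem: "pair_code_param n (G * Q) G x y \<in> pair_code n (G * Q) G"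
    if "x \<in> carrier_vec (degree R)" "y \<in> carrier_vec (degree Q)" for x y
  proof -
    have "?P x y = code_poly x * (G * Q) + lift_poly (code_poly y) * (2 * G)" by (simp add: ac_simps)
    then have "G dvd ?P x y \<and> G * Q dvd 2 * ?P x y"
      using pair_ideal_mem_iff[OF m(1,2), of "?P x y"] by blast
    then show ?thesis unfolding pair_code_def
      using code[OF that] by (simp add: pair_code_param_def)
  qed
  show ?thesis
  proof (rule bij_betw_imageI)
    show "inj_on (\<lambda>(x, y). pair_code_param n (G * Q) G x y) (carrier_vec (degree R) \<times> carrier_vec (degree Q))"
    proof (rule inj_onI; clarify)
      fix x x' y y' assume c: "x \<in> carrier_vec (degree R)" "y \<in> carrier_vec (degree Q)"
        "x' \<in> carrier_vec (degree R)" "y' \<in> carrier_vec (degree Q)"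
        and eq: "pair_code_param n (G * Q) G x y = pair_code_param n (G * Q) G x' y'"
      let ?a = "code_poly x - code_poly x'" and ?b = "lift_poly (code_poly y') - lift_poly (code_poly y)"
      have "?P x y = ?P x' y'" using eq code[OF c(1,2)] code[OF c(3,4)] by (simp only:)
      moreover have "G * (?a * Q) - G * (2 * ?b) = ?P x y - ?P x' y'" by (simp add: algebra_simps)
      ultimately have "G * (?a * Q) = G * (2 * ?b)" by (simp only: diff_self right_minus_eq)
      then have aQ: "Q * ?a = 2 * ?b" using monic_mult_cancel[OF m(1)] by (simp add: mult.commute)
      have "?b = 0 \<or> degree ?b < degree Q"
        by (rule degree_less_diff[OF lp[OF cp[OF c(4)]] lp[OF cp[OF c(2)]]])
      then have b: "2 * ?b = 0 \<or> degree (2 * ?b) < degree Q" by (rule degree_less_double)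
      \<comment> \<open>Multiplying a nonzero \<open>?a\<close> by the monic \<open>Q\<close> gives
        degree at least \<open>degree Q\<close>, while \<open>2 * ?b\<close> stays below it.\<close>
      have "?a = 0"
      proof (rule ccontr)
        assume "?a \<noteq> 0"
        then have "degree (2 * ?b) = degree Q + degree ?a" "2 * ?b \<noteq> 0"
          using degree_monic_mult[OF m(2)] monic_mult_eq_0_iff[OF m(2)] unfolding aQ[symmetric] by blast+
        with b show False by simp
      qed
      then have "2 * ?b = 0" using aQ by simp
      then have "2 * lift_poly (code_poly y') = 2 * lift_poly (code_poly y)"
        by (simp only: right_diff_distrib right_minus_eq)
      then have "code_poly y = code_poly y'" unfolding double_eq_iff by simp
      with \<open>?a = 0\<close> show "x = x' \<and> y = y'"
        using c code_poly_inject[of x x'] code_poly_inject[of y y'] by auto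
    qed
    show "(\<lambda>(x, y). pair_code_param n (G * Q) G x y) ` (carrier_vec (degree R) \<times> carrier_vec (degree Q))
      = pair_code n (G * Q) G"
    proof (rule equalityI; rule subsetI)
      fix c assume c: "c \<in> pair_code n (G * Q) G"
      then have dim: "dim_vec c = n" by (simp add: pair_code_def)
      from c obtain u w where uw: "code_poly c = u * (G * Q) + w * (2 * G)"
        using pair_ideal_mem_iff[OF m(1,2), of "code_poly c"] unfolding pair_code_def by blast
      \<comment> \<open>Only \<open>2 * w\<close> matters, so \<open>w\<close> may be divided by
        \<open>Q\<close> modulo 2. The quotient part contributes 2 s G Q and is absorbed into the
        coefficient of \<open>G * Q\<close>.\<close>
      obtain s b where b: "red w = red Q * s + b" "b = 0 \<or> degree b < degree (red Q)"
        using monic_division[OF monic_red(2)[OF m(2)]] by metis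
      have "2 * w = 2 * (Q * lift_poly s + lift_poly b)"
        unfolding double_eq_iff by (simp add: b red2_poly.hom_add red2_poly.hom_mult)
      moreover have "w * (2 * G) = 2 * w * G" by (simp add: ac_simps)
      ultimately have w: "w * (2 * G) = 2 * (Q * lift_poly s + lift_poly b) * G" by (simp only:)
      \<comment> \<open>Reducing the new coefficient modulo \<open>R\<close> changes the word by a
        multiple of G Q R = x^n - 1, which the degree bounds later force to be zero.\<close>
      obtain t a where a: "u + 2 * lift_poly s = R * t + a" "a = 0 \<or> degree a < degree R"
        using monic_division[OF m(3)] by metis
      define x where "x = vec (degree R) (coeff a)"
      define y where "y = vec (degree Q) (coeff b)"
      have x: "x \<in> carrier_vec (degree R)" "code_poly x = a"
        using code_poly_vec_coeff[OF a(2)] by (simp_all add: x_def)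
      have y: "y \<in> carrier_vec (degree Q)" "code_poly y = b"
        using code_poly_vec_coeff b(2) monic_red(1)[OF m(2)] by (simp_all add: y_def)
      have "code_poly c = (u + 2 * lift_poly s) * (G * Q) + 2 * lift_poly b * G"
        unfolding uw w by (simp add: algebra_simps)
      also have "\<dots> = xn1 n * t + ?P x y" unfolding a(1) GQR[symmetric] x y by (simp add: algebra_simps)
      finally have cx: "xn1 n * t = code_poly c - ?P x y" by (simp add: algebra_simps)
      have "code_poly c - ?P x y = 0 \<or> degree (code_poly c - ?P x y) < n"
        by (rule degree_less_diff[OF cp[OF carrier_vecI[OF dim]] deg[OF x(1) y(1)]])
      moreover have "degree (xn1 n * t) \<ge> n" if "t \<noteq> 0"
        using degree_monic_mult[OF conjunct1[OF monic_xn1[OF n]] that] conjunct2[OF monic_xn1[OF n, where 'a=4]]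
        by simp
      ultimately have "xn1 n * t = 0" unfolding cx[symmetric] by (cases "t = 0") auto
      then have "code_poly c = ?P x y" using cx by simp
      then have "code_poly c = code_poly (pair_code_param n (G * Q) G x y)" using code[OF x(1) y(1)] by simp
      then have "c = pair_code_param n (G * Q) G x y"
        by (intro code_poly_inject) (simp_all add: dim pair_code_param_def)
      then show "c \<in> (\<lambda>(x, y). pair_code_param n (G * Q) G x y) ` (carrier_vec (degree R) \<times> carrier_vec (degree Q))"
        using x(1) y(1) by auto
    qed (auto intro: mem)
  qed
qed

lemma pair_code_subset: "pair_code n a b \<subseteq> carrier_vec n"
  by (auto simp: pair_code_def)

lemma zero_in_pair_code: "0\<^sub>v n \<in> pair_code n a b"
proof -
  have "code_poly (0\<^sub>v n) = (0 :: 4 poly)" by (rule poly_eqI) (simp add: coeff_code_poly)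
  then show ?thesis by (simp add: pair_code_def)
qed

lemma generated_by_pair_iff:
  fixes p q :: "4 poly"
  assumes "n > 0" "monic p" "monic q" "p * q dvd xn1 n"
  shows "generated_by n C {p * q, 2 * p} \<longleftrightarrow> C = pair_code n (p * q) p"
  unfolding generated_by_iff[OF assms(1)] Idl_pair[OF assms(2-4)] pair_code_def by simp

lemma generated_by_z4v_iff:
  assumes n: "n > 0" and m: "monic G1" "monic Q1" "monic G2" "monic Q2"
    and dvd: "G1 * Q1 dvd xn1 n" "G2 * Q2 dvd xn1 n"
  shows "generated_by n C {emb_poly vv (G1 * Q1), emb_poly (2 * vv) G1,
      emb_poly (1 - vv) (G2 * Q2), emb_poly (2 * (1 - vv)) G2} \<longleftrightarrow>
    C = {c \<in> carrier_vec n. map_vec at1 c \<in> pair_code n (G1 * Q1) G1 \<and> map_vec at0 c \<in> pair_code n (G2 * Q2) G2}"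
  unfolding generated_by_iff[OF n] Idl_z4v Idl_pair[OF m(1,2) dvd(1)] Idl_pair[OF m(3,4) dvd(2)] pair_code_def
  by (simp add: code_poly_map_vec conj_ac cong: conj_cong)

section \<open>Joining the parameter spaces of the two components\<close>

lemma vec_first_add:
  "x \<in> carrier_vec m \<Longrightarrow> y \<in> carrier_vec m \<Longrightarrow> k \<le> m \<Longrightarrow> vec_first (x + y) k = vec_first x k + vec_first y k"
  by (auto simp: vec_first_def)

lemma vec_last_add:
  "x \<in> carrier_vec m \<Longrightarrow> y \<in> carrier_vec m \<Longrightarrow> k \<le> m \<Longrightarrow> vec_last (x + y) k = vec_last x k + vec_last y k"
  by (auto simp: vec_last_def)

lemma vec_first_smult: "k \<le> dim_vec x \<Longrightarrow> vec_first (a \<cdot>\<^sub>v x) k = a \<cdot>\<^sub>v vec_first x k"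
  by (auto simp: vec_first_def)

lemma vec_last_smult: "k \<le> dim_vec x \<Longrightarrow> vec_last (a \<cdot>\<^sub>v x) k = a \<cdot>\<^sub>v vec_last x k"
  by (auto simp: vec_last_def)

lemma vec_first_append: "x \<in> carrier_vec k \<Longrightarrow> vec_first (x @\<^sub>v y) k = x"
  by (auto simp: vec_first_def)

lemma vec_last_append: "y \<in> carrier_vec k \<Longrightarrow> vec_last (x @\<^sub>v y) k = y"
  by (auto simp: vec_last_def)

lemma vec_first_last_inject:
  assumes "x \<in> carrier_vec (k + m)" "y \<in> carrier_vec (k + m)"
    "vec_first x k = vec_first y k" "vec_last x m = vec_last y m"
  shows "x = y"
  using assms vec_first_last_append by metis

lemma v_join_add:
  assumes "c1 \<in> carrier_vec n" "c2 \<in> carrier_vec n" "d1 \<in> carrier_vec n" "d2 \<in> carrier_vec n"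
  shows "v_join (c1 + d1) (c2 + d2) = v_join c1 c2 + v_join d1 d2"
  using assms by (intro eq_vecI) (auto simp: v_join_def emb_hom algebra_simps)

lemma v_join_smult:
  assumes "c1 \<in> carrier_vec n" "c2 \<in> carrier_vec n"
  shows "v_join (a \<cdot>\<^sub>v c1) (a \<cdot>\<^sub>v c2) = emb a \<cdot>\<^sub>v v_join c1 c2"
  using assms by (intro eq_vecI) (auto simp: v_join_def emb_hom algebra_simps)

lemma v_join_inject:
  assumes "c1 \<in> carrier_vec n" "c2 \<in> carrier_vec n" "d1 \<in> carrier_vec n" "d2 \<in> carrier_vec n"
    "v_join c1 c2 = v_join d1 d2"
  shows "c1 = d1 \<and> c2 = d2"
  using assms at_v_join by metis

lemma pair_code_param_carrier: "pair_code_param n a b x y \<in> carrier_vec n"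
  by (simp add: pair_code_param_def)

text \<open>The free parameters of both components are concatenated into one Z4-vector and the
  binary ones into one bit vector. Cutting these vectors and applying the two parametrizations gives
  the isomorphism; \<open>emb a\<close> acts as \<open>a\<close> on both components.\<close>

lemma of_type_v_join:
  assumes n: "n > 0" and m: "monic G1" "monic Q1" "monic R1" "monic G2" "monic Q2" "monic R2"
    and X: "G1 * Q1 * R1 = xn1 n" "G2 * Q2 * R2 = xn1 n"
  shows "of_type n {c \<in> carrier_vec n. map_vec at1 c \<in> pair_code n (G1 * Q1) G1 \<and> map_vec at0 c \<in> pair_code n (G2 * Q2) G2}
    (degree R1 + degree R2) (degree Q1 + degree Q2)"
proof -
  let ?C = "{c \<in> carrier_vec n. map_vec at1 c \<in> pair_code n (G1 * Q1) G1 \<and> map_vec at0 c \<in> pair_code n (G2 * Q2) G2}"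
  let ?P1 = "pair_code_param n (G1 * Q1) G1" and ?P2 = "pair_code_param n (G2 * Q2) G2"
  let ?r1 = "degree R1" and ?r2 = "degree R2" and ?q1 = "degree Q1" and ?q2 = "degree Q2"
  let ?D = "carrier_vec (?r1 + ?r2) \<times> carrier_vec (?q1 + ?q2) :: (4 vec \<times> bit vec) set"
  define \<phi>1 where "\<phi>1 = (\<lambda>(x, y). ?P1 (vec_first x ?r1) (vec_first y ?q1))"
  define \<phi>2 where "\<phi>2 = (\<lambda>(x, y). ?P2 (vec_last x ?r2) (vec_last y ?q2))"
  define \<phi> where "\<phi> = (\<lambda>z. v_join (\<phi>1 z) (\<phi>2 z))"
  have carr: "\<phi>1 z \<in> carrier_vec n" "\<phi>2 z \<in> carrier_vec n" for z
    by (simp_all add: \<phi>1_def \<phi>2_def pair_code_param_carrier split: prod.split)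
  note bij1 = pair_code_param_bij[OF n m(1-3) X(1)] and bij2 = pair_code_param_bij[OF n m(4-6) X(2)]
  have code: "\<phi>1 z \<in> pair_code n (G1 * Q1) G1" "\<phi>2 z \<in> pair_code n (G2 * Q2) G2" for z
    using bij_betwE[OF bij1] bij_betwE[OF bij2] by (auto simp: \<phi>1_def \<phi>2_def split: prod.split)
  have closed: "\<phi> z \<in> ?C" for z
    unfolding \<phi>_def using at_v_join[OF carr, of z z] v_join_carrier[OF carr] code by auto
  have inj: "inj_on \<phi> ?D"
  proof (rule inj_onI)
    fix z z' assume z: "z \<in> ?D" "z' \<in> ?D" and eq: "\<phi> z = \<phi> z'"
    obtain x y x' y' where xy: "z = (x, y)" "z' = (x', y')" by (cases z; cases z')
    from eq have "\<phi>1 z = \<phi>1 z'" "\<phi>2 z = \<phi>2 z'" using v_join_inject[OF carr carr] unfolding \<phi>_def by blast+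
    then have "vec_first x ?r1 = vec_first x' ?r1 \<and> vec_first y ?q1 = vec_first y' ?q1"
      "vec_last x ?r2 = vec_last x' ?r2 \<and> vec_last y ?q2 = vec_last y' ?q2"
      using inj_onD[OF bij_betw_imp_inj_on[OF bij1], of "(vec_first x ?r1, vec_first y ?q1)" "(vec_first x' ?r1, vec_first y' ?q1)"]
        inj_onD[OF bij_betw_imp_inj_on[OF bij2], of "(vec_last x ?r2, vec_last y ?q2)" "(vec_last x' ?r2, vec_last y' ?q2)"]
      by (simp_all add: \<phi>1_def \<phi>2_def xy)
    then show "z = z'"
      using z vec_first_last_inject[of x ?r1 ?r2 x'] vec_first_last_inject[of y ?q1 ?q2 y'] by (simp add: xy)
  qed
  have surj: "?C \<subseteq> \<phi> ` ?D"
  proof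
    fix c assume c: "c \<in> ?C"
    then obtain x1 y1 x2 y2 where xy: "x1 \<in> carrier_vec ?r1" "y1 \<in> carrier_vec ?q1" "map_vec at1 c = ?P1 x1 y1"
      "x2 \<in> carrier_vec ?r2" "y2 \<in> carrier_vec ?q2" "map_vec at0 c = ?P2 x2 y2"
      using bij_betw_imp_surj_on[OF bij1, symmetric] bij_betw_imp_surj_on[OF bij2, symmetric] by auto
    then have "\<phi> (x1 @\<^sub>v x2, y1 @\<^sub>v y2) = v_join (map_vec at1 c) (map_vec at0 c)"
      by (simp add: \<phi>_def \<phi>1_def \<phi>2_def vec_first_append vec_last_append)
    then have "c = \<phi> (x1 @\<^sub>v x2, y1 @\<^sub>v y2)" by (simp only: v_join_at)
    moreover have "(x1 @\<^sub>v x2, y1 @\<^sub>v y2) \<in> ?D" using xy by simp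
    ultimately show "c \<in> \<phi> ` ?D" by (rule image_eqI)
  qed
  have bij: "bij_betw \<phi> ?D ?C"
    using inj surj closed by (intro bij_betw_imageI) auto
  have add: "\<phi> (x + x', y + y') = \<phi> (x, y) + \<phi> (x', y')" if "(x, y) \<in> ?D" "(x', y') \<in> ?D" for x y x' y'
  proof -
    have "\<phi>1 (x + x', y + y') = \<phi>1 (x, y) + \<phi>1 (x', y')" "\<phi>2 (x + x', y + y') = \<phi>2 (x, y) + \<phi>2 (x', y')"
      using that by (simp_all add: \<phi>1_def \<phi>2_def vec_first_add[of _ "?r1 + ?r2"] vec_first_add[of _ "?q1 + ?q2"]
        vec_last_add[of _ "?r1 + ?r2"] vec_last_add[of _ "?q1 + ?q2"]
        pair_code_param_add[OF vec_first_carrier vec_first_carrier vec_first_carrier vec_first_carrier]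
        pair_code_param_add[OF vec_last_carrier vec_last_carrier vec_last_carrier vec_last_carrier])
    then show ?thesis unfolding \<phi>_def by (simp add: v_join_add[OF carr carr])
  qed
  have smult: "\<phi> (a \<cdot>\<^sub>v x, red2 a \<cdot>\<^sub>v y) = emb a \<cdot>\<^sub>v \<phi> (x, y)" if "(x, y) \<in> ?D" for a x y
  proof -
    have d: "dim_vec x = ?r1 + ?r2" "dim_vec y = ?q1 + ?q2" using that by auto
    have "\<phi>1 (a \<cdot>\<^sub>v x, red2 a \<cdot>\<^sub>v y) = a \<cdot>\<^sub>v \<phi>1 (x, y)" "\<phi>2 (a \<cdot>\<^sub>v x, red2 a \<cdot>\<^sub>v y) = a \<cdot>\<^sub>v \<phi>2 (x, y)"
      by (simp_all add: d \<phi>1_def \<phi>2_def vec_first_smult vec_last_smult pair_code_param_smult)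
    then show ?thesis unfolding \<phi>_def by (simp add: v_join_smult[OF carr])
  qed
  have "\<phi> \<in> LinearCombinations.module_hom class_ring (std_module (?r1 + ?r2) (?q1 + ?q2)) (module_of_code n ?C)"
    unfolding LinearCombinations.module_hom_def std_module_def module_of_code_def
    using closed by (auto simp: add smult simp del: mem_Collect_eq)
  then show ?thesis
    unfolding of_type_def using bij by (intro bexI[of _ \<phi>]) (simp_all add: std_module_def module_of_code_def)
qed

theorem theorem3p9:
  fixes n :: nat
    and C :: "z4v vec set" and C1 C2 :: "4 vec set"
    and p1 q1 r1 p2 q2 r2 :: "4 poly"
  assumes "odd n"
    and "cyclic_code n C"
    and "linear_code n C1" and "linear_code n C2"
    and "C = v_sum C1 C2"
    and "lead_coeff p1 = 1" and "lead_coeff q1 = 1" and "lead_coeff r1 = 1"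
    and "lead_coeff p2 = 1" and "lead_coeff q2 = 1" and "lead_coeff r2 = 1"
    and "p1 * q1 * r1 = xn1 n" and "p2 * q2 * r2 = xn1 n"
    and "generated_by n C1 {p1 * q1, 2 * p1}"
    and "generated_by n C2 {p2 * q2, 2 * p2}"
    and "generated_by n C
      {emb_poly vv (p1 * q1), emb_poly (2 * vv) p1,
       emb_poly (1 - vv) (p2 * q2), emb_poly (2 * (1 - vv)) p2}"
  shows "generated_by n (hull_code n C)
      {emb_poly vv (lcm_xn1 n (p1 * q1) (reciprocal r1 * reciprocal q1)),
       emb_poly (2 * vv) (lcm_xn1 n p1 (reciprocal r1)),
       emb_poly (1 - vv) (lcm_xn1 n (p2 * q2) (reciprocal r2 * reciprocal q2)),
       emb_poly (2 * (1 - vv)) (lcm_xn1 n p2 (reciprocal r2))}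
    \<and> (let R1 = gcd_xn1 n r1 (reciprocal p1);
           R2 = gcd_xn1 n r2 (reciprocal p2);
           Q1 = exact_quotient (xn1 n)
                  (gcd_xn1 n r1 (reciprocal p1) * lcm_xn1 n p1 (reciprocal r1));
           Q2 = exact_quotient (xn1 n)
                  (gcd_xn1 n r2 (reciprocal p2) * lcm_xn1 n p2 (reciprocal r2))
       in of_type n (hull_code n C) (degree R1 + degree R2) (degree Q1 + degree Q2))"
proof -
  have n: "n > 0" using assms(1) by (rule odd_pos)
  note h1 = hull_pair_code[OF assms(1,6-8,12)] and h2 = hull_pair_code[OF assms(1,9-11,13)]
  have "C1 = pair_code n (p1 * q1) p1"
    using generated_by_pair_iff[OF n assms(6,7) dvdI[OF assms(12)[symmetric]]] assms(14) by blast
  moreover have "C2 = pair_code n (p2 * q2) p2"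
    using generated_by_pair_iff[OF n assms(9,10) dvdI[OF assms(13)[symmetric]]] assms(15) by blast
  ultimately have hull: "hull_code n C = {c \<in> carrier_vec n.
      map_vec at1 c \<in> hull_code n (pair_code n (p1 * q1) p1) \<and>
      map_vec at0 c \<in> hull_code n (pair_code n (p2 * q2) p2)}"
    unfolding assms(5) by (simp only: hull_code_v_sum[OF pair_code_subset pair_code_subset
          zero_in_pair_code zero_in_pair_code])
  show ?thesis
    \<comment> \<open>Rewriting each larger lcm as \<open>G * Q\<close> brings the claimed
      generators and the hull to the form required for generation and type.\<close>
    unfolding Let_def hull h1(1,2) h2(1,2)
    using generated_by_z4v_iff[OF n h1(4,5) h2(4,5) dvdI[OF h1(3)[symmetric]] dvdI[OF h2(3)[symmetric]]]
      of_type_v_join[OF n h1(4-6) h2(4-6) h1(3) h2(3)]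
    by blast
qed

end
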